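(* Let $A=(D,\sigma,d)$ be a generalized cyclic Azumaya algebra, i.e. $d\in S_0^\times$. (i) Every $\tau\in\mathrm{Aut}_{S_0}(D)$ that commutes with $\sigma$ can be extended to an automorphism $$H_{\tau,k}\Big(\sum_{i=0}^{m-1}a_it^i\Big)=\sum_{i=0}^{m-1}\tau(a_i)(kt)^i=\tau(a_0)+\sum_{i=1}^{m-1}\tau(a_i)\Big(\prod_{l=0}^{i-1}\sigma^l(k)\Big)t^i$$ in $\mathrm{Aut}_{S_0}(A)$ for some $k\in C^\times$ such that $N_{C/S_0}(k)=1$. All maps $H_{\tau,k}$, where $\tau\in\mathrm{Aut}_{S_0}(D)$ commutes with $\sigma$ and where $k\in C^\times$ is such that $N_{C/S_0}(k)=1$, are automorphisms of $A$. (ii) The subgroup of $S_0$-automorphisms extending some fixed $\tau\in\mathrm{Aut}_{S_0}(D)$ is isomorphic to $$\{k\in C^\times\mid N_{C/S_0}(k)=1\}.$$ (iii) Suppose that $S_0$ contains a primitive $m$th root of unity $\omega$, and let $\tau\in\mathrm{Aut}_{S_0}(D)$ commute with $\sigma$. If $\tau$ has finite order $s$, then the cyclic subgroup $\langle H_{\tau,\omega}\rangle$ of $\mathrm{Aut}_{S_0}(A)$ generated by $H_{\tau,\omega}$ has order $ms$. (If $\tau$ has infinite order then this subgroup has infinite order.) Furthermore, $\langle H_{id,\omega}\rangle$ is a cyclic subgroup of $\mathrm{Aut}_{S_0}((D,\sigma,d))$ of order $m$. (iv) $\{\tau\in\mathrm{Aut}_{S_0}(D)\mid \tau\circ\sigma=\sigma\circ\tau\}$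 is isomorphic to a subgroup of $\mathrm{Aut}_{S_0}(A)$.
   Context: All rings are unital. $D$ is an Azumaya algebra with center $C$ (associative, finitely generated as a $C$-module, separable over $C$, center exactly $C$), of constant rank over $C$. $\sigma$ is a ring automorphism of $D$ such that $\sigma|_C$ has finite order $m\ge 2$; $\mathrm{Fix}(\sigma)=\{a\in D\mid\sigma(a)=a\}$ and $S_0=\mathrm{Fix}(\sigma)\cap C$. It is assumed that $C/S_0$ is a Galois extension of commutative rings (in the sense of Chase–Harrison–Rosenberg) with cyclic Galois group $\langle\sigma|_C\rangle$ of order $m$: $C$ is a faithfully projective $S_0$-module of constant rank $m$ and $C\otimes_{S_0}C\to\prod_{j=0}^{m-1}C$, $x\otimes y\mapsto (x\sigma^j(y))_j$, is an isomorphism. $D[t;\sigma]$ is the skew polynomial ring of left polynomials $\sum a_it^i$, $a_i\in D$, with $ta=\sigma(a)t$ for $a\in D$. For $d\in S_0^\times$ let $f(t)=t^m-d$. The generalized cyclic Azumaya algebra $(D,\sigma,d)=D[t;\sigma]/D[t;\sigma]f$ is the additive group $\{g\in D[t;\sigma]\mid \deg g<m\}$ with multiplication $g\circ h$ = remainder of $gh$ under right division by $f$ (i.e. the unique $r$ with $gh=qf+r$, $\deg r<m$), regarded as an algebra over $S_0$; the definition of a generalized cyclic Azumaya algebra refers to it as an associative algebra. $\mathrm{Aut}_{S_0}$ denotes the group of $S_0$-algebra automorphisms. $N_{C/S_0}(k)=\prod_{l=0}^{m-1}\sigma^l(k)$ for $k\in C$. The maps $H_{\tau,\omega}$ and $H_{id,\omega}$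 in (iii) are given by the formula in (i) with $k=\omega$.
   Formalization: (iii): the order ms is false (D=C=Q(i), τ=σ conjugation, ω=-1: order 2, not 4); proved: lcm(m,s), which is ms if m,s are coprime. (ii): extensions of τ form a subgroup only for τ=id; proved: the isomorphism then, a coset otherwise, and a bijection with {k: N(k)=1} if τ commutes with σ. *)

theory Defs
  imports "HOL-Algebra.Algebra"
begin

section \<open>Modules and algebras as records\<close>

text \<open>The library locale \<open>module\<close> only covers commutative scalar rings. The notions below are also
  needed over a noncommutative ring of scalars (left modules over an enveloping algebra), so they
  are stated for the bare records. In an algebra record both \<open>mult\<close> and \<open>smult\<close> are used; in a mere
  module the fields \<open>mult\<close> and \<open>one\<close> are irrelevant.\<close>

text \<open>A ring as an algebra over any of its central subrings.\<close>

definition self_algebra :: "('a, 'm) ring_scheme \<Rightarrow> ('a, 'a) module" where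
  "self_algebra R = \<lparr>carrier = carrier R, monoid.mult = monoid.mult R, one = one R,
     ring.zero = ring.zero R, ring.add = ring.add R, smult = monoid.mult R\<rparr>"

definition opposite_algebra ::
  "('r, 'a, 'm) module_scheme \<Rightarrow> ('r, 'a, 'm) module_scheme" where
  "opposite_algebra A = A\<lparr>monoid.mult := \<lambda>x y. y \<otimes>\<^bsub>A\<^esub> x\<rparr>"

definition linear_maps ::
  "('r, 'x) ring_scheme \<Rightarrow> ('r, 'a, 'm) module_scheme \<Rightarrow> ('r, 'b, 'n) module_scheme
    \<Rightarrow> ('a \<Rightarrow> 'b) set" where
  "linear_maps R M N = {h \<in> carrier M \<rightarrow> carrier N.
     (\<forall>x\<in>carrier M. \<forall>y\<in>carrier M. h (x \<oplus>\<^bsub>M\<^esub> y) = h x \<oplus>\<^bsub>N\<^esub> h y) \<and>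
     (\<forall>r\<in>carrier R. \<forall>x\<in>carrier M. h (r \<odot>\<^bsub>M\<^esub> x) = r \<odot>\<^bsub>N\<^esub> h x)}"

definition free_module :: "('r, 'x) ring_scheme \<Rightarrow> 'i set \<Rightarrow> ('r, 'i \<Rightarrow> 'r) module" where
  "free_module R I = \<lparr>carrier = {v \<in> I \<rightarrow>\<^sub>E carrier R. finite {i \<in> I. v i \<noteq> \<zero>\<^bsub>R\<^esub>}},
     monoid.mult = undefined, one = undefined,
     ring.zero = (\<lambda>i\<in>I. \<zero>\<^bsub>R\<^esub>), ring.add = (\<lambda>v w. \<lambda>i\<in>I. v i \<oplus>\<^bsub>R\<^esub> w i),
     smult = (\<lambda>r v. \<lambda>i\<in>I. r \<otimes>\<^bsub>R\<^esub> v i)\<rparr>"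

text \<open>Projective: a direct summand of a free module. Basis sets inside the type of the module
  elements suffice, because every module \<open>M\<close> is a quotient of the free module on \<open>carrier M\<close>.\<close>

definition projective_module ::
  "('r, 'x) ring_scheme \<Rightarrow> ('r, 'a, 'm) module_scheme \<Rightarrow> bool" where
  "projective_module R M \<longleftrightarrow>
     (\<exists>I :: 'a set. \<exists>\<iota>\<in>linear_maps R M (free_module R I). \<exists>\<pi>\<in>linear_maps R (free_module R I) M.
        \<forall>x\<in>carrier M. \<pi> (\<iota> x) = x)"

definition fin_gen_module ::
  "('r, 'x) ring_scheme \<Rightarrow> ('r, 'a, 'm) module_scheme \<Rightarrow> bool" where
  "fin_gen_module R M \<longleftrightarrow>
     (\<exists>U. finite U \<and> U \<subseteq> carrier M \<and>
        (\<forall>x\<in>carrier M. \<exists>a\<in>U \<rightarrow> carrier R. x = (\<Oplus>\<^bsub>M\<^esub>b\<in>U. a b \<odot>\<^bsub>M\<^esub> b)))"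

definition faithful_module ::
  "('r, 'x) ring_scheme \<Rightarrow> ('r, 'a, 'm) module_scheme \<Rightarrow> bool" where
  "faithful_module R M \<longleftrightarrow>
     (\<forall>r\<in>carrier R. (\<forall>x\<in>carrier M. r \<odot>\<^bsub>M\<^esub> x = \<zero>\<^bsub>M\<^esub>) \<longrightarrow> r = \<zero>\<^bsub>R\<^esub>)"

definition faithfully_projective ::
  "('r, 'x) ring_scheme \<Rightarrow> ('r, 'a, 'm) module_scheme \<Rightarrow> bool" where
  "faithfully_projective R M \<longleftrightarrow>
     fin_gen_module R M \<and> projective_module R M \<and> faithful_module R M"


section \<open>Localization at a prime and constant rank\<close>

text \<open>\<open>loc_frac R M P x s\<close> is the fraction \<open>x / s\<close>, as an equivalence class of pairs.\<close>

definition loc_frac ::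
  "('r, 'x) ring_scheme \<Rightarrow> ('r, 'a, 'm) module_scheme \<Rightarrow> 'r set \<Rightarrow> 'a \<Rightarrow> 'r \<Rightarrow> ('a \<times> 'r) set" where
  "loc_frac R M P x s = {(y, t). y \<in> carrier M \<and> t \<in> carrier R - P \<and>
     (\<exists>u\<in>carrier R - P. u \<odot>\<^bsub>M\<^esub> (t \<odot>\<^bsub>M\<^esub> x) = u \<odot>\<^bsub>M\<^esub> (s \<odot>\<^bsub>M\<^esub> y))}"

text \<open>The operations are defined on representatives, in the style of \<open>rcoset_mult\<close>: all members
  of each of the unions below are equal. Scalars are elements of the localized ring
  \<open>localization R (self_algebra R) P\<close>.\<close>

definition localization ::
  "('r, 'x) ring_scheme \<Rightarrow> ('r, 'a, 'm) module_scheme \<Rightarrow> 'r set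
    \<Rightarrow> (('r \<times> 'r) set, ('a \<times> 'r) set) module" where
  "localization R M P =
     \<lparr>carrier = {loc_frac R M P x s | x s. x \<in> carrier M \<and> s \<in> carrier R - P},
      monoid.mult = (\<lambda>U V. \<Union>(x, s)\<in>U. \<Union>(y, t)\<in>V. loc_frac R M P (x \<otimes>\<^bsub>M\<^esub> y) (s \<otimes>\<^bsub>R\<^esub> t)),
      one = loc_frac R M P \<one>\<^bsub>M\<^esub> \<one>\<^bsub>R\<^esub>,
      ring.zero = loc_frac R M P \<zero>\<^bsub>M\<^esub> \<one>\<^bsub>R\<^esub>,
      ring.add = (\<lambda>U V. \<Union>(x, s)\<in>U. \<Union>(y, t)\<in>V.
               loc_frac R M P (t \<odot>\<^bsub>M\<^esub> x \<oplus>\<^bsub>M\<^esub> s \<odot>\<^bsub>M\<^esub> y) (s \<otimes>\<^bsub>R\<^esub> t)),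
      smult = (\<lambda>A V. \<Union>(r, s)\<in>A. \<Union>(y, t)\<in>V. loc_frac R M P (r \<odot>\<^bsub>M\<^esub> y) (s \<otimes>\<^bsub>R\<^esub> t))\<rparr>"

definition free_of_rank ::
  "('r, 'x) ring_scheme \<Rightarrow> ('r, 'a, 'm) module_scheme \<Rightarrow> nat \<Rightarrow> bool" where
  "free_of_rank R M n \<longleftrightarrow>
     (\<exists>b\<in>{..<n} \<rightarrow> carrier M. \<forall>x\<in>carrier M.
        \<exists>!a. a \<in> {..<n} \<rightarrow>\<^sub>E carrier R \<and> x = (\<Oplus>\<^bsub>M\<^esub>i\<in>{..<n}. a i \<odot>\<^bsub>M\<^esub> b i))"

definition has_constant_rank ::
  "('r, 'x) ring_scheme \<Rightarrow> ('r, 'a, 'm) module_scheme \<Rightarrow> nat \<Rightarrow> bool" where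
  "has_constant_rank R M n \<longleftrightarrow>
     (\<forall>P. primeideal P R \<longrightarrow>
        free_of_rank (localization R (self_algebra R) P) (localization R M P) n)"


section \<open>Tensor products\<close>

text \<open>The tensor product over \<open>R\<close> is the free abelian group on \<open>carrier A \<times> carrier B\<close> modulo the
  subgroup generated by the biadditivity and balancing relations; its elements are cosets.\<close>

definition tensor_free ::
  "('r, 'a, 'm) module_scheme \<Rightarrow> ('r, 'b, 'n) module_scheme \<Rightarrow> (('a \<times> 'b) \<Rightarrow>\<^sub>0 int) monoid" where
  "tensor_free A B = free_Abelian_group (carrier A \<times> carrier B)"

definition tensor_relations ::
  "('r, 'x) ring_scheme \<Rightarrow> ('r, 'a, 'm) module_scheme \<Rightarrow> ('r, 'b, 'n) module_scheme
    \<Rightarrow> (('a \<times> 'b) \<Rightarrow>\<^sub>0 int) set" where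
  "tensor_relations R A B = generate (tensor_free A B)
     ({frag_of (x \<oplus>\<^bsub>A\<^esub> x', y) - frag_of (x, y) - frag_of (x', y) | x x' y.
         x \<in> carrier A \<and> x' \<in> carrier A \<and> y \<in> carrier B} \<union>
      {frag_of (x, y \<oplus>\<^bsub>B\<^esub> y') - frag_of (x, y) - frag_of (x, y') | x y y'.
         x \<in> carrier A \<and> y \<in> carrier B \<and> y' \<in> carrier B} \<union>
      {frag_of (r \<odot>\<^bsub>A\<^esub> x, y) - frag_of (x, r \<odot>\<^bsub>B\<^esub> y) | r x y.
         r \<in> carrier R \<and> x \<in> carrier A \<and> y \<in> carrier B})"

definition tensor_class ::
  "('r, 'x) ring_scheme \<Rightarrow> ('r, 'a, 'm) module_scheme \<Rightarrow> ('r, 'b, 'n) module_scheme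
    \<Rightarrow> (('a \<times> 'b) \<Rightarrow>\<^sub>0 int) \<Rightarrow> (('a \<times> 'b) \<Rightarrow>\<^sub>0 int) set" where
  "tensor_class R A B p = tensor_relations R A B #>\<^bsub>tensor_free A B\<^esub> p"

abbreviation pure_tensor ::
  "('r, 'x) ring_scheme \<Rightarrow> ('r, 'a, 'm) module_scheme \<Rightarrow> ('r, 'b, 'n) module_scheme
    \<Rightarrow> 'a \<Rightarrow> 'b \<Rightarrow> (('a \<times> 'b) \<Rightarrow>\<^sub>0 int) set" where
  "pure_tensor R A B x y \<equiv> tensor_class R A B (frag_of (x, y))"

text \<open>The ring structure of a tensor product of algebras: \<open>frag_extend\<close> extends
  \<open>(x \<otimes> y) (x' \<otimes> y') = x x' \<otimes> y y'\<close> biadditively to formal sums.\<close>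

definition tensor_algebra ::
  "('r, 'x) ring_scheme \<Rightarrow> ('r, 'a, 'm) module_scheme \<Rightarrow> ('r, 'b, 'n) module_scheme
    \<Rightarrow> (('a \<times> 'b) \<Rightarrow>\<^sub>0 int) set ring" where
  "tensor_algebra R A B =
     \<lparr>carrier = carrier (tensor_free A B Mod tensor_relations R A B),
      monoid.mult = (\<lambda>U V. \<Union>p\<in>U. \<Union>q\<in>V. tensor_class R A B
        (frag_extend (\<lambda>u. frag_extend
           (\<lambda>v. frag_of (fst u \<otimes>\<^bsub>A\<^esub> fst v, snd u \<otimes>\<^bsub>B\<^esub> snd v)) q) p)),
      one = pure_tensor R A B \<one>\<^bsub>A\<^esub> \<one>\<^bsub>B\<^esub>,
      ring.zero = \<one>\<^bsub>tensor_free A B Mod tensor_relations R A B\<^esub>,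
      ring.add = monoid.mult (tensor_free A B Mod tensor_relations R A B)\<rparr>"


section \<open>Azumaya algebras and cyclic Galois extensions\<close>

text \<open>\<open>A\<close> as a left module over its enveloping algebra \<open>A \<otimes> A\<^sup>o\<^sup>p\<close>, by
  \<open>(a \<otimes> b) x = a x b\<close>.\<close>

definition enveloping_module ::
  "('r, 'a, 'm) module_scheme \<Rightarrow> ((('a \<times> 'a) \<Rightarrow>\<^sub>0 int) set, 'a) module" where
  "enveloping_module A =
     \<lparr>carrier = carrier A, monoid.mult = monoid.mult A, one = one A,
      ring.zero = ring.zero A, ring.add = ring.add A,
      smult = (\<lambda>U x. THE y. \<forall>p\<in>U. y =
        (\<Oplus>\<^bsub>A\<^esub>u\<in>Poly_Mapping.keys p.
           add_pow A (Poly_Mapping.lookup p u) (fst u \<otimes>\<^bsub>A\<^esub> x \<otimes>\<^bsub>A\<^esub> snd u)))\<rparr>"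

definition separable_algebra ::
  "('r, 'x) ring_scheme \<Rightarrow> ('r, 'a, 'm) module_scheme \<Rightarrow> bool" where
  "separable_algebra R A \<longleftrightarrow>
     projective_module (tensor_algebra R A (opposite_algebra A)) (enveloping_module A)"

definition ring_center :: "('a, 'm) ring_scheme \<Rightarrow> 'a set" where
  "ring_center D = {c \<in> carrier D. \<forall>a\<in>carrier D. c \<otimes>\<^bsub>D\<^esub> a = a \<otimes>\<^bsub>D\<^esub> c}"

abbreviation center_ring :: "('a, 'm) ring_scheme \<Rightarrow> ('a, 'm) ring_scheme" where
  "center_ring D \<equiv> D\<lparr>carrier := ring_center D\<rparr>"

text \<open>Azumaya over its own center.\<close>

definition azumaya :: "('a, 'm) ring_scheme \<Rightarrow> bool" where
  "azumaya D \<longleftrightarrow> ring D \<and>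
     fin_gen_module (center_ring D) (self_algebra D) \<and>
     separable_algebra (center_ring D) (self_algebra D)"

definition power_ring :: "('a, 'm) ring_scheme \<Rightarrow> nat \<Rightarrow> (nat \<Rightarrow> 'a) ring" where
  "power_ring R m = \<lparr>carrier = {..<m} \<rightarrow>\<^sub>E carrier R,
     monoid.mult = (\<lambda>v w. \<lambda>j\<in>{..<m}. v j \<otimes>\<^bsub>R\<^esub> w j), one = (\<lambda>j\<in>{..<m}. \<one>\<^bsub>R\<^esub>),
     ring.zero = (\<lambda>j\<in>{..<m}. \<zero>\<^bsub>R\<^esub>), ring.add = (\<lambda>v w. \<lambda>j\<in>{..<m}. v j \<oplus>\<^bsub>R\<^esub> w j)\<rparr>"

text \<open>\<open>C\<close> is a Galois extension of its subring \<open>S\<close>, with cyclic group of order \<open>m\<close> generated by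
  \<open>\<rho>\<close> (that \<open>\<rho>\<close> has order \<open>m\<close> and fixes \<open>S\<close> is to be assumed in addition). The isomorphism is
  determined by its values on pure tensors.\<close>

definition cyclic_galois_extension ::
  "('a, 'x) ring_scheme \<Rightarrow> ('a, 'm) ring_scheme \<Rightarrow> ('a \<Rightarrow> 'a) \<Rightarrow> nat \<Rightarrow> bool" where
  "cyclic_galois_extension S C \<rho> m \<longleftrightarrow>
     faithfully_projective S (self_algebra C) \<and>
     has_constant_rank S (self_algebra C) m \<and>
     (\<exists>\<phi>\<in>ring_iso (tensor_algebra S (self_algebra C) (self_algebra C)) (power_ring C m).
        \<forall>x\<in>carrier C. \<forall>y\<in>carrier C.
          \<phi> (pure_tensor S (self_algebra C) (self_algebra C) x y)
            = (\<lambda>j\<in>{..<m}. x \<otimes>\<^bsub>C\<^esub> (\<rho> ^^ j) y))"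


section \<open>Skew polynomials and generalized cyclic algebras\<close>

text \<open>The ring \<open>S\<^sub>0\<close> of central elements fixed by \<open>\<sigma>\<close>.\<close>

abbreviation base_ring :: "('a, 'm) ring_scheme \<Rightarrow> ('a \<Rightarrow> 'a) \<Rightarrow> ('a, 'm) ring_scheme" where
  "base_ring D \<sigma> \<equiv> D\<lparr>carrier := {a \<in> carrier D. \<sigma> a = a} \<inter> ring_center D\<rparr>"

text \<open>A skew polynomial is its sequence of left coefficients; \<open>up D\<close> is the library's set of
  finitely supported coefficient sequences. The product is \<open>(a t\<^sup>i) (b t\<^sup>j) = a \<sigma>\<^sup>i(b) t\<^sup>i\<^sup>+\<^sup>j\<close>.\<close>

definition skew_poly_ring :: "('a, 'm) ring_scheme \<Rightarrow> ('a \<Rightarrow> 'a) \<Rightarrow> (nat \<Rightarrow> 'a) ring" where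
  "skew_poly_ring D \<sigma> =
     \<lparr>carrier = up D,
      monoid.mult = (\<lambda>g h n. \<Oplus>\<^bsub>D\<^esub>i\<in>{..n}. g i \<otimes>\<^bsub>D\<^esub> (\<sigma> ^^ i) (h (n - i))),
      one = (\<lambda>i. if i = 0 then \<one>\<^bsub>D\<^esub> else \<zero>\<^bsub>D\<^esub>),
      ring.zero = (\<lambda>i. \<zero>\<^bsub>D\<^esub>),
      ring.add = (\<lambda>g h i. g i \<oplus>\<^bsub>D\<^esub> h i)\<rparr>"

text \<open>The monomial \<open>a t\<^sup>n\<close>.\<close>

definition skew_monom :: "('a, 'm) ring_scheme \<Rightarrow> 'a \<Rightarrow> nat \<Rightarrow> nat \<Rightarrow> 'a" where
  "skew_monom D a n = (\<lambda>i. if i = n then a else \<zero>\<^bsub>D\<^esub>)"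

definition skew_polys_below :: "('a, 'm) ring_scheme \<Rightarrow> nat \<Rightarrow> (nat \<Rightarrow> 'a) set" where
  "skew_polys_below D m = {g \<in> up D. \<forall>i\<ge>m. g i = \<zero>\<^bsub>D\<^esub>}"

text \<open>The remainder of \<open>g\<close> under right division by \<open>t\<^sup>m - d\<close>.\<close>

definition skew_remainder ::
  "('a, 'm) ring_scheme \<Rightarrow> ('a \<Rightarrow> 'a) \<Rightarrow> nat \<Rightarrow> 'a \<Rightarrow> (nat \<Rightarrow> 'a) \<Rightarrow> (nat \<Rightarrow> 'a)" where
  "skew_remainder D \<sigma> m d g = (THE r. r \<in> skew_polys_below D m \<and>
     (\<exists>q\<in>carrier (skew_poly_ring D \<sigma>).
        g = q \<otimes>\<^bsub>skew_poly_ring D \<sigma>\<^esub> (skew_monom D \<one>\<^bsub>D\<^esub> m \<ominus>\<^bsub>skew_poly_ring D \<sigma>\<^esub> skew_monom D d 0)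
              \<oplus>\<^bsub>skew_poly_ring D \<sigma>\<^esub> r))"

text \<open>The algebra \<open>(D, \<sigma>, d)\<close> of degree \<open>m\<close> over \<open>S\<^sub>0\<close>. In general it is not
  associative.\<close>

definition gen_cyclic_algebra ::
  "('a, 'm) ring_scheme \<Rightarrow> ('a \<Rightarrow> 'a) \<Rightarrow> nat \<Rightarrow> 'a \<Rightarrow> ('a, nat \<Rightarrow> 'a) module" where
  "gen_cyclic_algebra D \<sigma> m d =
     \<lparr>carrier = skew_polys_below D m,
      monoid.mult = (\<lambda>g h. skew_remainder D \<sigma> m d (g \<otimes>\<^bsub>skew_poly_ring D \<sigma>\<^esub> h)),
      one = \<one>\<^bsub>skew_poly_ring D \<sigma>\<^esub>,
      ring.zero = \<zero>\<^bsub>skew_poly_ring D \<sigma>\<^esub>,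
      ring.add = ring.add (skew_poly_ring D \<sigma>),
      smult = (\<lambda>s g i. s \<otimes>\<^bsub>D\<^esub> g i)\<rparr>"

definition associative_algebra :: "('a, 'm) ring_scheme \<Rightarrow> bool" where
  "associative_algebra A \<longleftrightarrow> (\<forall>x\<in>carrier A. \<forall>y\<in>carrier A. \<forall>z\<in>carrier A.
     (x \<otimes>\<^bsub>A\<^esub> y) \<otimes>\<^bsub>A\<^esub> z = x \<otimes>\<^bsub>A\<^esub> (y \<otimes>\<^bsub>A\<^esub> z))"


section \<open>Automorphisms\<close>

text \<open>The group of unital \<open>S\<close>-algebra automorphisms. As in \<open>BijGroup\<close>, its elements are
  extensional functions, so that distinct elements differ on the carrier.\<close>

definition algebra_Aut ::
  "('r, 'x) ring_scheme \<Rightarrow> ('r, 'a, 'm) module_scheme \<Rightarrow> ('a \<Rightarrow> 'a) monoid" where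
  "algebra_Aut S A = (BijGroup (carrier A))
     \<lparr>carrier := Bij (carrier A) \<inter> ring_hom A A \<inter> linear_maps S A A\<rparr>"

definition cyclic_norm :: "('a, 'm) ring_scheme \<Rightarrow> ('a \<Rightarrow> 'a) \<Rightarrow> nat \<Rightarrow> 'a \<Rightarrow> 'a" where
  "cyclic_norm D \<sigma> m k = (\<Otimes>\<^bsub>center_ring D\<^esub>l\<in>{..<m}. (\<sigma> ^^ l) k)"

definition norm_one_group :: "('a, 'm) ring_scheme \<Rightarrow> ('a \<Rightarrow> 'a) \<Rightarrow> nat \<Rightarrow> 'a monoid" where
  "norm_one_group D \<sigma> m = (units_of (center_ring D))
     \<lparr>carrier := {k \<in> Units (center_ring D). cyclic_norm D \<sigma> m k = \<one>\<^bsub>D\<^esub>}\<rparr>"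

text \<open>The map \<open>H\<^bsub>\<tau>,k\<^esub>\<close>; \<open>cyclic_norm D \<sigma> i k\<close> is the partial product of \<open>\<sigma>\<^sup>l(k)\<close>
  over \<open>l < i\<close>.\<close>

definition H_map ::
  "('a, 'm) ring_scheme \<Rightarrow> ('a \<Rightarrow> 'a) \<Rightarrow> nat \<Rightarrow> ('a \<Rightarrow> 'a) \<Rightarrow> 'a \<Rightarrow> (nat \<Rightarrow> 'a) \<Rightarrow> (nat \<Rightarrow> 'a)" where
  "H_map D \<sigma> m \<tau> k =
     (\<lambda>g\<in>skew_polys_below D m. \<lambda>i. \<tau> (g i) \<otimes>\<^bsub>D\<^esub> cyclic_norm D \<sigma> i k)"

definition extensions_of ::
  "('a, 'm) ring_scheme \<Rightarrow> ((nat \<Rightarrow> 'a) \<Rightarrow> (nat \<Rightarrow> 'a)) monoid \<Rightarrow> ('a \<Rightarrow> 'a)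
    \<Rightarrow> ((nat \<Rightarrow> 'a) \<Rightarrow> (nat \<Rightarrow> 'a)) set" where
  "extensions_of D G \<tau> =
     {H \<in> carrier G. \<forall>a\<in>carrier D. H (skew_monom D a 0) = skew_monom D (\<tau> a) 0}"

end

theory Submission
  imports Defs
begin

text \<open>The key point is that an automorphism \<open>F\<close> of \<open>A\<close> extending \<open>\<tau>\<close> is determined by
  \<open>u = F(t)\<close>. Applying \<open>F\<close> to \<open>t a = \<sigma>(a) t\<close> gives \<open>u\<^sub>i \<sigma>\<^sup>i(b) = \<sigma>(b) u\<^sub>i\<close> for all \<open>b\<close>, and the
  Galois isomorphism separates \<open>\<sigma>\<^sup>i\<close> from \<open>\<sigma>\<close> on \<open>C\<close> for \<open>i \<noteq> 1\<close>, so that \<open>u = k t\<close> with \<open>k\<close> central; the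
  relation \<open>t\<^sup>m = d\<close> then forces \<open>N(k) = 1\<close>. Hence the extensions of \<open>\<tau>\<close> are exactly the \<open>H\<^bsub>\<tau>,k\<^esub>\<close>, and
  the group statements follow from \<open>H\<^bsub>\<tau>,k\<^esub> \<circ> H\<^bsub>\<tau>',k'\<^esub> = H\<^bsub>\<tau>\<tau>',\<tau>(k')k\<^esub>\<close>.\<close>

section \<open>Skew polynomials\<close>

text \<open>That each \<open>H \<tau> k\<close> is an automorphism rests on how a product in
  \<open>A\<close> is reduced. The factors have degree below \<open>m\<close>, so one division step
  suffices: a skew polynomial product p leaves the coefficients p_n + p_{n+m} d. Applying
  \<open>H \<tau> k\<close> attaches the partial norm N_n(k) to degree n, and N_{n+m}(k) = N_n(k)
  \<sigma>^n(N(k)); norm one therefore gives the carried part the same factor as the part already in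
  place. The composition law also dictates the form of the group statements. The identity of
  \<open>A\<close> extends \<tau> only when \<tau> is the identity of \<open>D\<close>, so the
  extensions of any other \<tau>, if there are some, form a coset and not a subgroup. For \<omega>
  in S0 the law gives H_{\<tau>,\<omega>}^n = H_{\<tau>^n,\<omega>^n}, which is the identity exactly
  when m and the order s of \<tau> both divide n. The cyclic subgroup has order lcm(m, s), which
  equals m s exactly when m and s are coprime.\<close>

locale skew_ring = ring D for D :: "('a, 'x) ring_scheme" (structure) +
  fixes \<sigma> :: "'a \<Rightarrow> 'a"
  assumes sigma_iso: "\<sigma> \<in> ring_iso D D"
begin

abbreviation skew_prod (infixl "\<star>" 70) where
  "g \<star> h \<equiv> g \<otimes>\<^bsub>skew_poly_ring D \<sigma>\<^esub> h"

abbreviation monomial :: "'a \<Rightarrow> nat \<Rightarrow> nat \<Rightarrow> 'a" where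
  "monomial \<equiv> skew_monom D"

lemma sigma_hom: "\<sigma> \<in> ring_hom D D"
  using sigma_iso by (simp add: ring_iso_def)

lemma sigma_bij: "bij_betw \<sigma> (carrier D) (carrier D)"
  using sigma_iso by (simp add: ring_iso_def)

lemma sigma_pow_hom: "\<sigma> ^^ i \<in> ring_hom D D"
proof (induction i)
  case 0
  then show ?case by (simp add: ring_hom_def)
next
  case (Suc i)
  then show ?case using ring_hom_trans[OF Suc sigma_hom] by (simp add: comp_def)
qed

sublocale sigma: ring_hom_ring D D \<sigma>
  by (rule ring_hom_ringI2[OF ring_axioms ring_axioms sigma_hom])

sublocale sigma_pow: ring_hom_ring D D "\<sigma> ^^ i" for i
  by (rule ring_hom_ringI2[OF ring_axioms ring_axioms sigma_pow_hom])

lemma sigma_pow_add: "(\<sigma> ^^ i) ((\<sigma> ^^ j) a) = (\<sigma> ^^ (i + j)) a"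
  by (simp add: funpow_add)

lemma skew_prod_coeff: "(g \<star> h) n = (\<Oplus>i\<in>{..n}. g i \<otimes> (\<sigma> ^^ i) (h (n - i)))"
  by (simp add: skew_poly_ring_def)

lemma skew_prod_closed:
  assumes "\<And>i. g i \<in> carrier D" "\<And>i. h i \<in> carrier D"
  shows "(g \<star> h) n \<in> carrier D"
  unfolding skew_prod_coeff by (rule finsum_closed) (auto simp: assms)

lemma skew_prod_monomial_left:
  assumes "a \<in> carrier D" "\<And>i. h i \<in> carrier D"
  shows "(monomial a i \<star> h) n = (if i \<le> n then a \<otimes> (\<sigma> ^^ i) (h (n - i)) else \<zero>)"
proof -
  have "(monomial a i \<star> h) n = (\<Oplus>j\<in>{..n}. if i = j then a \<otimes> (\<sigma> ^^ j) (h (n - j)) else \<zero>)"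
    unfolding skew_prod_coeff skew_monom_def
    by (rule finsum_cong') (auto simp: assms)
  also have "\<dots> = (if i \<le> n then a \<otimes> (\<sigma> ^^ i) (h (n - i)) else \<zero>)"
  proof (cases "i \<le> n")
    case True
    then show ?thesis
      using finsum_singleton[of i "{..n}" "\<lambda>j. a \<otimes> (\<sigma> ^^ j) (h (n - j))"] assms by auto
  next
    case False
    then have "(\<Oplus>j\<in>{..n}. if i = j then a \<otimes> (\<sigma> ^^ j) (h (n - j)) else \<zero>) = (\<Oplus>j\<in>{..n}. \<zero>)"
      by (intro finsum_cong') auto
    with False show ?thesis by simp
  qed
  finally show ?thesis .
qed

lemma skew_prod_monomial_right:
  assumes "b \<in> carrier D" "\<And>i. g i \<in> carrier D"
  shows "(g \<star> monomial b j) n = (if j \<le> n then g (n - j) \<otimes> (\<sigma> ^^ (n - j)) b else \<zero>)"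
proof (cases "j \<le> n")
  case True
  have "(g \<star> monomial b j) n = (\<Oplus>i\<in>{..n}. if n - j = i then g i \<otimes> (\<sigma> ^^ i) b else \<zero>)"
    unfolding skew_prod_coeff skew_monom_def
    by (rule finsum_cong') (use True assms in auto)
  then show ?thesis
    using True finsum_singleton[of "n - j" "{..n}" "\<lambda>i. g i \<otimes> (\<sigma> ^^ i) b"] assms by auto
next
  case False
  then have "(g \<star> monomial b j) n = (\<Oplus>i\<in>{..n}. \<zero>)"
    unfolding skew_prod_coeff skew_monom_def
    by (intro finsum_cong') (auto simp: assms)
  with False show ?thesis by simp
qed

lemma skew_prod_add_right:
  assumes "\<And>i. g i \<in> carrier D" "\<And>i. h i \<in> carrier D" "\<And>i. h' i \<in> carrier D"
  shows "(g \<star> (\<lambda>i. h i \<oplus> h' i)) n = (g \<star> h) n \<oplus> (g \<star> h') n"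
proof -
  have "(g \<star> (\<lambda>i. h i \<oplus> h' i)) n =
      (\<Oplus>i\<in>{..n}. g i \<otimes> (\<sigma> ^^ i) (h (n - i)) \<oplus> g i \<otimes> (\<sigma> ^^ i) (h' (n - i)))"
    unfolding skew_prod_coeff by (rule finsum_cong') (auto simp: assms r_distr)
  also have "\<dots> = (g \<star> h) n \<oplus> (g \<star> h') n"
    unfolding skew_prod_coeff by (rule finsum_addf) (auto simp: assms)
  finally show ?thesis .
qed

text \<open>Either \<open>m \<le> i\<close> or \<open>m \<le> n - i\<close>, so each summand has a
  vanishing factor. The bound \<open>2 * m\<close> is what makes a single carry across degree
  \<open>m\<close> enough when a product is reduced.\<close>

lemma skew_prod_degree:
  assumes "g \<in> skew_polys_below D m" "h \<in> skew_polys_below D m" "2 * m \<le> n"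
  shows "(g \<star> h) n = \<zero>"
proof -
  have "g i \<otimes> (\<sigma> ^^ i) (h (n - i)) = \<zero>" if "i \<le> n" for i
  proof (cases "m \<le> i")
    case True
    then show ?thesis using assms by (auto simp: skew_polys_below_def up_def Pi_def)
  next
    case False
    then have "m \<le> n - i" using assms that by linarith
    then show ?thesis using assms by (auto simp: skew_polys_below_def up_def Pi_def)
  qed
  then have "(g \<star> h) n = (\<Oplus>i\<in>{..n}. \<zero>)"
    unfolding skew_prod_coeff by (intro finsum_cong') auto
  then show ?thesis by simp
qed

text \<open>Vanishing from \<open>m\<close> on already gives finite support: \<open>m\<close> serves
  as the bound, which \<open>bound\<close> reads strictly.\<close>

lemma skew_polys_below_iff:
  "g \<in> skew_polys_below D m \<longleftrightarrow> (\<forall>i. g i \<in> carrier D) \<and> (\<forall>i\<ge>m. g i = \<zero>)"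
  unfolding skew_polys_below_def up_def bound_def by (auto simp: Pi_def) (meson less_imp_le)

text \<open>Gives the subtraction in the divisor t^m - d a computable meaning: negation in a ring
  record is the inverse of the additive monoid, and the group axioms identify it with the
  coefficientwise negative.\<close>

lemma skew_poly_abelian_group: "abelian_group (skew_poly_ring D \<sigma>)"
proof (rule abelian_groupI, goal_cases)
  case (1 x y)
  then show ?case by (simp add: skew_poly_ring_def up_add_closed)
next
  case 2
  show ?case by (auto simp: skew_poly_ring_def up_def bound_def)
next
  case (3 x y z)
  then show ?case by (auto simp: skew_poly_ring_def up_def a_assoc Pi_def)
next
  case (4 x y)
  then show ?case by (auto simp: skew_poly_ring_def up_def a_comm Pi_def)
next
  case (5 x)
  then show ?case by (auto simp: skew_poly_ring_def up_def Pi_def)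
next
  case (6 x)
  then show ?case
    using up_a_inv_closed[of x]
    by (intro bexI[of _ "\<lambda>i. \<ominus> x i"]) (auto simp: skew_poly_ring_def mem_upD l_neg)
qed

lemma monomial_closed: "a \<in> carrier D \<Longrightarrow> monomial a n i \<in> carrier D"
  by (simp add: skew_monom_def)

lemma monomial_up: "a \<in> carrier D \<Longrightarrow> monomial a n \<in> up D"
  by (auto simp: skew_monom_def up_def bound_def)

lemma skew_poly_minus_monomial:
  assumes "a \<in> carrier D" "g \<in> up D"
  shows "g \<ominus>\<^bsub>skew_poly_ring D \<sigma>\<^esub> monomial a n = (\<lambda>i. g i \<oplus> monomial (\<ominus> a) n i)"
proof -
  have "\<ominus>\<^bsub>skew_poly_ring D \<sigma>\<^esub> monomial a n = monomial (\<ominus> a) n"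
    by (rule abelian_group.minus_equality[OF skew_poly_abelian_group])
      (auto simp: skew_poly_ring_def monomial_up assms l_neg, auto simp: skew_monom_def assms l_neg)
  then show ?thesis by (simp add: a_minus_def skew_poly_ring_def)
qed

text \<open>Since \<sigma> fixes \<open>d\<close>, the coefficient of q (t^m - d) at n is q_{n-m} -
  q_n d. Splitting p at degree \<open>m\<close> suggests the quotient q_n = p_{n+m}, and the degree
  bound on p makes this division exact after one step. Uniqueness of the remainder comes from the
  finite support of any competing quotient.\<close>

lemma skew_remainder_eq:
  assumes m: "m > 0" and d: "d \<in> carrier D" "\<sigma> d = d"
    and p: "\<And>i. p i \<in> carrier D" "\<And>i. 2 * m \<le> i \<Longrightarrow> p i = \<zero>"
  shows "skew_remainder D \<sigma> m d p = (\<lambda>n. if n < m then p n \<oplus> p (n + m) \<otimes> d else \<zero>)"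
    (is "_ = ?r")
proof -
  define f where "f = monomial \<one> m \<ominus>\<^bsub>skew_poly_ring D \<sigma>\<^esub> monomial d 0"
  have d_pow: "(\<sigma> ^^ i) d = d" for i
    by (induction i) (simp_all add: d)
  have f_coeff: "(q \<star> f) n = (if m \<le> n then q (n - m) else \<zero>) \<ominus> q n \<otimes> d"
    if "\<And>i. q i \<in> carrier D" for q n
  proof -
    have "(q \<star> f) n = (q \<star> monomial \<one> m) n \<oplus> (q \<star> monomial (\<ominus> d) 0) n"
      unfolding f_def using d that
      by (simp add: skew_poly_minus_monomial monomial_up skew_prod_add_right monomial_closed)
    also have "\<dots> = (if m \<le> n then q (n - m) else \<zero>) \<oplus> (q n \<otimes> (\<ominus> d))"
      using d that by (simp add: skew_prod_monomial_right d_pow)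
    finally show ?thesis using d that by (simp add: a_minus_def r_minus)
  qed
  define rem where "rem r q \<longleftrightarrow> q \<in> carrier (skew_poly_ring D \<sigma>) \<and>
    p = q \<star> f \<oplus>\<^bsub>skew_poly_ring D \<sigma>\<^esub> r" for r q
  have remI: "rem r q" if "\<And>n. p n = (q \<star> f) n \<oplus> r n" "q \<in> up D" for r q
    using that by (auto simp: rem_def skew_poly_ring_def fun_eq_iff)
  have remD: "q \<in> up D" "p n = (q \<star> f) n \<oplus> r n" if "rem r q" for r q n
    using that by (auto simp: rem_def skew_poly_ring_def fun_eq_iff)
  have ex: "rem ?r (\<lambda>i. p (i + m))"
  proof (rule remI)
    show "(\<lambda>i. p (i + m)) \<in> up D"
      using p by (auto simp: up_def bound_def intro!: exI[of _ "2 * m"])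
    fix n
    show "p n = ((\<lambda>i. p (i + m)) \<star> f) n \<oplus> ?r n"
    proof (cases "n < m")
      case True
      have "\<zero> \<ominus> x \<oplus> (y \<oplus> x) = y" if "x \<in> carrier D" "y \<in> carrier D" for x y
        using that by algebra
      then show ?thesis using True p d by (simp add: f_coeff)
    next
      case False
      \<comment> \<open>For \<open>m \<le> n\<close> the degree bound gives
        \<open>p (n + m) = \<zero>\<close>, so the term with \<open>d\<close> drops out and the
        shifted quotient returns \<open>p n\<close>.\<close>
      then show ?thesis using p(1)[of n] p(2)[of "n + m"] d p(1) by (simp add: f_coeff a_minus_def)
    qed
  qed
  have rem_unique: "r = ?r"
    if r: "r \<in> skew_polys_below D m" and rem: "rem r q" for r q
  proof -
    have q: "q i \<in> carrier D" for i
      using remD(1)[OF rem] by (auto simp: up_def Pi_def)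
    have rc: "\<And>i. r i \<in> carrier D" and r0: "\<And>i. i \<ge> m \<Longrightarrow> r i = \<zero>"
      using r by (auto simp: skew_polys_below_iff)
    \<comment> \<open>The coefficient at \<open>n + m\<close> of the division identity, where the
      remainder vanishes.\<close>
    have step: "p (n + m) = q n \<ominus> q (n + m) \<otimes> d" for n
      using remD(2)[OF rem, of "n + m"] q d by (simp add: f_coeff r0)
    have q_eq: "q n = p (n + m) \<oplus> q (n + m) \<otimes> d" for n
    proof -
      have "x = (x \<ominus> y) \<oplus> y" if "x \<in> carrier D" "y \<in> carrier D" for x y
        using that by algebra
      then show ?thesis using step[of n] q d by simp
    qed
    obtain B where B: "\<And>i. i > B \<Longrightarrow> q i = \<zero>"
      using remD(1)[OF rem] by (auto simp: up_def bound_def)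
    \<comment> \<open>Descending induction from the support bound \<open>B\<close>: for
      \<open>n \<ge> m\<close> the recursion reads \<open>q n = q (n + m) \<otimes> d\<close>, and
      \<open>m > 0\<close> makes the measure decrease.\<close>
    have q0: "q n = \<zero>" if "n \<ge> m" for n
      using that
    proof (induction "Suc B - n" arbitrary: n rule: less_induct)
      case less
      show ?case
      proof (cases "n > B")
        case False
        then have "q (n + m) = \<zero>" using less m by (intro less(1)) auto
        then show ?thesis using q_eq[of n] p(2)[of "n + m"] less(2) d by simp
      qed (rule B)
    qed
    have q': "q n = p (n + m)" for n
      using q_eq[of n] q0[of "n + m"] d p by simp
    show "r = ?r"
    proof
      fix n
      show "r n = ?r n"
      proof (cases "n < m")
        case True
        have "x = (\<zero> \<ominus> y \<oplus> x) \<oplus> y" if "x \<in> carrier D" "y \<in> carrier D" for x y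
          using that by algebra
        then show ?thesis using remD(2)[OF rem, of n] True q d rc by (simp add: f_coeff q')
      qed (simp add: r0)
    qed
  qed
  have "(THE r. r \<in> skew_polys_below D m \<and> (\<exists>q. rem r q)) = ?r"
  proof (rule the_equality)
    show "?r \<in> skew_polys_below D m \<and> (\<exists>q. rem ?r q)"
      using ex p d by (auto simp: skew_polys_below_iff)
  qed (use rem_unique in blast)
  then show ?thesis unfolding skew_remainder_def rem_def f_def Bex_def by simp
qed

end

section \<open>Automorphism groups and the center\<close>

lemma BijGroup_mult: "\<lbrakk>f \<in> Bij S; g \<in> Bij S\<rbrakk> \<Longrightarrow> f \<otimes>\<^bsub>BijGroup S\<^esub> g = compose S f g"
  by (simp add: BijGroup_def)

lemma algebra_Aut_iff:
  "F \<in> carrier (algebra_Aut S A) \<longleftrightarrow> F \<in> Bij (carrier A) \<and>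
     (\<forall>x\<in>carrier A. \<forall>y\<in>carrier A. F (x \<otimes>\<^bsub>A\<^esub> y) = F x \<otimes>\<^bsub>A\<^esub> F y) \<and>
     (\<forall>x\<in>carrier A. \<forall>y\<in>carrier A. F (x \<oplus>\<^bsub>A\<^esub> y) = F x \<oplus>\<^bsub>A\<^esub> F y) \<and>
     F \<one>\<^bsub>A\<^esub> = \<one>\<^bsub>A\<^esub> \<and>
     (\<forall>r\<in>carrier S. \<forall>x\<in>carrier A. F (r \<odot>\<^bsub>A\<^esub> x) = r \<odot>\<^bsub>A\<^esub> F x)"
  using Bij_imp_funcset[of F "carrier A"]
  by (auto simp: algebra_Aut_def ring_hom_def linear_maps_def)

lemma algebra_Aut_one: "\<one>\<^bsub>algebra_Aut S A\<^esub> = (\<lambda>x\<in>carrier A. x)"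
  by (simp add: algebra_Aut_def BijGroup_def)

lemma algebra_Aut_mult:
  assumes "F \<in> carrier (algebra_Aut S A)" "G \<in> carrier (algebra_Aut S A)"
  shows "F \<otimes>\<^bsub>algebra_Aut S A\<^esub> G = compose (carrier A) F G"
  using assms by (simp add: algebra_Aut_def BijGroup_mult)

text \<open>Stated for bare records, so that it applies to \<open>D\<close> over S0 as well as to
  \<open>A\<close>. The preservation conditions pass to composites directly and to inverses by
  writing each argument as an image under the bijection.\<close>

lemma group_algebra_Aut:
  fixes A :: "('r, 'a, 'm) module_scheme"
  assumes mult: "\<And>x y. \<lbrakk>x \<in> carrier A; y \<in> carrier A\<rbrakk> \<Longrightarrow> x \<otimes>\<^bsub>A\<^esub> y \<in> carrier A"
    and add: "\<And>x y. \<lbrakk>x \<in> carrier A; y \<in> carrier A\<rbrakk> \<Longrightarrow> x \<oplus>\<^bsub>A\<^esub> y \<in> carrier A"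
    and one: "\<one>\<^bsub>A\<^esub> \<in> carrier A"
    and smult: "\<And>r x. \<lbrakk>r \<in> carrier S; x \<in> carrier A\<rbrakk> \<Longrightarrow> r \<odot>\<^bsub>A\<^esub> x \<in> carrier A"
  shows "group (algebra_Aut S A)"
proof -
  let ?B = "BijGroup (carrier A)"
  interpret B: group ?B by (rule group_BijGroup)
  have Bij: "F \<in> Bij (carrier A)" if "F \<in> carrier (algebra_Aut S A)" for F
    using that by (simp add: algebra_Aut_iff)
  have "subgroup (carrier (algebra_Aut S A)) ?B"
  proof (rule B.subgroupI)
    show "carrier (algebra_Aut S A) \<subseteq> carrier ?B"
      using Bij by (auto simp: BijGroup_def)
    show "carrier (algebra_Aut S A) \<noteq> {}"
    proof -
      have "(\<lambda>x\<in>carrier A. x) \<in> carrier (algebra_Aut S A)"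
        unfolding algebra_Aut_iff using assms by (simp add: id_Bij)
      then show ?thesis by blast
    qed
  next
    fix F assume F: "F \<in> carrier (algebra_Aut S A)"
    let ?G = "\<lambda>x\<in>carrier A. inv_into (carrier A) F x"
    have inv: "inv_into (carrier A) F y = x" if "x \<in> carrier A" "y = F x" for x y
      using that Bij[OF F] by (simp add: Bij_def bij_betw_def)
    have pre: "\<exists>x\<in>carrier A. y = F x" if "y \<in> carrier A" for y
      using that Bij[OF F] by (auto simp: Bij_def bij_betw_def)
    have im: "F x \<in> carrier A" if "x \<in> carrier A" for x
      using that Bij_imp_funcset[OF Bij[OF F]] by blast
    have "?G \<in> carrier (algebra_Aut S A)"
      unfolding algebra_Aut_iff
    proof (intro conjI ballI)
      show "?G \<in> Bij (carrier A)" using Bij[OF F] by (rule restrict_inv_into_Bij)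
      fix x y assume "x \<in> carrier A" "y \<in> carrier A"
      then obtain x' y' where x': "x' \<in> carrier A" "x = F x'" and y': "y' \<in> carrier A" "y = F y'"
        using pre by metis
      show "?G (x \<otimes>\<^bsub>A\<^esub> y) = ?G x \<otimes>\<^bsub>A\<^esub> ?G y"
        using F x' y' by (simp add: inv[of x'] inv[of y'] im mult algebra_Aut_iff
            inv[of "x' \<otimes>\<^bsub>A\<^esub> y'"])
      show "?G (x \<oplus>\<^bsub>A\<^esub> y) = ?G x \<oplus>\<^bsub>A\<^esub> ?G y"
        using F x' y' by (simp add: inv[of x'] inv[of y'] im add algebra_Aut_iff
            inv[of "x' \<oplus>\<^bsub>A\<^esub> y'"])
    next
      show "?G \<one>\<^bsub>A\<^esub> = \<one>\<^bsub>A\<^esub>"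
        using F one by (simp add: inv[of "\<one>\<^bsub>A\<^esub>"] algebra_Aut_iff)
    next
      fix r x assume "r \<in> carrier S" "x \<in> carrier A"
      moreover from this obtain x' where "x' \<in> carrier A" "x = F x'" using pre by metis
      ultimately show "?G (r \<odot>\<^bsub>A\<^esub> x) = r \<odot>\<^bsub>A\<^esub> ?G x"
        using F by (simp add: inv[of x'] im smult algebra_Aut_iff inv[of "r \<odot>\<^bsub>A\<^esub> x'"])
    qed
    then show "inv\<^bsub>?B\<^esub> F \<in> carrier (algebra_Aut S A)"
      by (simp add: inv_BijGroup Bij[OF F])
  next
    fix F G assume FG: "F \<in> carrier (algebra_Aut S A)" "G \<in> carrier (algebra_Aut S A)"
    have "G x \<in> carrier A" if "x \<in> carrier A" for x
      using that Bij_imp_funcset[OF Bij[OF FG(2)]] by blast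
    then have "compose (carrier A) F G \<in> carrier (algebra_Aut S A)"
      using FG assms unfolding algebra_Aut_iff by (simp add: compose_Bij compose_eq)
    then show "F \<otimes>\<^bsub>?B\<^esub> G \<in> carrier (algebra_Aut S A)"
      by (simp add: BijGroup_mult Bij FG)
  qed
  then have "group (?B\<lparr>carrier := carrier (algebra_Aut S A)\<rparr>)"
    by (rule subgroup.subgroup_is_group) (rule B.is_group)
  then show ?thesis by (simp add: algebra_Aut_def)
qed

context ring
begin

lemma ring_centerD:
  assumes "c \<in> ring_center R"
  shows "c \<in> carrier R" "a \<in> carrier R \<Longrightarrow> c \<otimes> a = a \<otimes> c"
  using assms by (auto simp: ring_center_def)

lemma ring_centerI:
  "\<lbrakk>c \<in> carrier R; \<And>a. a \<in> carrier R \<Longrightarrow> c \<otimes> a = a \<otimes> c\<rbrakk> \<Longrightarrow> c \<in> ring_center R"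
  by (simp add: ring_center_def)

lemma ring_center_subcring: "subcring (ring_center R) R"
proof (rule subcringI)
  show "subring (ring_center R) R"
  proof (rule subringI)
    show "ring_center R \<subseteq> carrier R" by (auto simp: ring_center_def)
    show "\<one> \<in> ring_center R" by (simp add: ring_center_def)
  next
    fix h assume h: "h \<in> ring_center R"
    show "\<ominus> h \<in> ring_center R"
      by (rule ring_centerI) (simp_all add: ring_centerD[OF h] l_minus r_minus)
  next
    fix h1 h2 assume h: "h1 \<in> ring_center R" "h2 \<in> ring_center R"
    note in_R = ring_centerD(1)[OF h(1)] ring_centerD(1)[OF h(2)]
    show "h1 \<otimes> h2 \<in> ring_center R"
    proof (rule ring_centerI)
      fix a assume a: "a \<in> carrier R"
      have "h1 \<otimes> h2 \<otimes> a = h1 \<otimes> (a \<otimes> h2)"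
        using in_R a ring_centerD(2)[OF h(2) a] by (simp add: m_assoc)
      also have "\<dots> = a \<otimes> h1 \<otimes> h2"
        using in_R a ring_centerD(2)[OF h(1) a] by (simp add: m_assoc[symmetric])
      finally show "h1 \<otimes> h2 \<otimes> a = a \<otimes> (h1 \<otimes> h2)"
        using in_R a by (simp add: m_assoc)
    qed (use in_R in simp)
    show "h1 \<oplus> h2 \<in> ring_center R"
      using in_R by (intro ring_centerI)
        (simp_all add: l_distr r_distr ring_centerD(2)[OF h(1)] ring_centerD(2)[OF h(2)])
  qed
qed (simp add: ring_centerD(2) ring_centerD(1))

lemma ring_center_cring: "cring (center_ring R)"
  using subcring_iff[of "ring_center R"] ring_center_subcring subcringE(1) by blast

text \<open>The image of a central element commutes with the image of \<tau>; surjectivity turns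
  this into centrality.\<close>

lemma ring_hom_ring_center:
  assumes "\<tau> \<in> ring_hom R R" "\<tau> ` carrier R = carrier R" "c \<in> ring_center R"
  shows "\<tau> c \<in> ring_center R"
proof -
  have "\<tau> c \<otimes> \<tau> a = \<tau> a \<otimes> \<tau> c" if "a \<in> carrier R" for a
    using assms that ring_centerD[OF assms(3)] by (metis ring_hom_mult)
  then have "\<tau> c \<otimes> b = b \<otimes> \<tau> c" if "b \<in> carrier R" for b
    using that assms(2) by (metis imageE)
  moreover have "\<tau> c \<in> carrier R"
    using assms(2) ring_centerD(1)[OF assms(3)] by blast
  ultimately show ?thesis by (rule ring_centerI[rotated])
qed

end

section \<open>Partial norms of central elements\<close>

context skew_ring
begin

lemma center_sigma_pow: "c \<in> ring_center D \<Longrightarrow> (\<sigma> ^^ i) c \<in> ring_center D"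
proof (induction i)
  case (Suc i)
  then show ?case
    using ring_hom_ring_center[OF sigma_hom] sigma_bij by (auto simp: bij_betw_def)
qed simp

lemma cyclic_norm_0 [simp]: "cyclic_norm D \<sigma> 0 k = \<one>"
proof -
  interpret C: cring "center_ring D" by (rule ring_center_cring)
  show ?thesis using C.finprod_empty by (simp add: cyclic_norm_def)
qed

lemma
  assumes "k \<in> ring_center D"
  shows cyclic_norm_center: "cyclic_norm D \<sigma> i k \<in> ring_center D"
    and cyclic_norm_Suc: "cyclic_norm D \<sigma> (Suc i) k = cyclic_norm D \<sigma> i k \<otimes> (\<sigma> ^^ i) k"
proof -
  interpret C: cring "center_ring D" by (rule ring_center_cring)
  note k_center = center_sigma_pow[OF assms]
  have k: "(\<lambda>l. (\<sigma> ^^ l) k) \<in> I \<rightarrow> carrier (center_ring D)" for I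
    using k_center by simp
  show norm: "cyclic_norm D \<sigma> i k \<in> ring_center D"
    unfolding cyclic_norm_def using C.finprod_closed[OF k] by simp
  have "cyclic_norm D \<sigma> (Suc i) k = (\<sigma> ^^ i) k \<otimes> cyclic_norm D \<sigma> i k"
    unfolding cyclic_norm_def lessThan_Suc
    using C.finprod_insert[OF _ _ k, of "{..<i}" i] k_center[of i] by simp
  also have "\<dots> = cyclic_norm D \<sigma> i k \<otimes> (\<sigma> ^^ i) k"
    by (rule ring_centerD(2)[OF k_center ring_centerD(1)[OF norm]])
  finally show "cyclic_norm D \<sigma> (Suc i) k = cyclic_norm D \<sigma> i k \<otimes> (\<sigma> ^^ i) k" .
qed

lemma cyclic_norm_closed: "k \<in> ring_center D \<Longrightarrow> cyclic_norm D \<sigma> i k \<in> carrier D"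
  using cyclic_norm_center ring_centerD by blast

text \<open>The cocycle identity of the partial norms, equivalent to (kt)^i (kt)^j = (kt)^{i+j} for
  skew polynomials. It yields the multiplicativity of the maps \<open>H\<close>, the periodicity of
  partial norms when the norm is one, and the inverse of a norm one element.\<close>

lemma cyclic_norm_add:
  assumes "k \<in> ring_center D"
  shows "cyclic_norm D \<sigma> (i + j) k = cyclic_norm D \<sigma> i k \<otimes> (\<sigma> ^^ i) (cyclic_norm D \<sigma> j k)"
proof (induction j)
  case 0
  then show ?case using assms by (simp add: cyclic_norm_closed)
next
  case (Suc j)
  have "cyclic_norm D \<sigma> i k \<otimes> (\<sigma> ^^ i) (cyclic_norm D \<sigma> (Suc j) k)
      = cyclic_norm D \<sigma> i k \<otimes> (\<sigma> ^^ i) (cyclic_norm D \<sigma> j k) \<otimes> (\<sigma> ^^ (i + j)) k"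
    using assms
    by (simp add: cyclic_norm_Suc cyclic_norm_closed m_assoc sigma_pow_add ring_centerD(1))
  then show ?case using Suc assms by (simp add: cyclic_norm_Suc)
qed

lemma cyclic_norm_mult:
  assumes "k \<in> ring_center D" "l \<in> ring_center D"
  shows "cyclic_norm D \<sigma> i (k \<otimes> l) = cyclic_norm D \<sigma> i k \<otimes> cyclic_norm D \<sigma> i l"
proof (induction i)
  case (Suc i)
  have kl: "k \<otimes> l \<in> ring_center D"
    using assms subcringE(6)[OF ring_center_subcring] by blast
  let ?a = "cyclic_norm D \<sigma> i k" and ?b = "cyclic_norm D \<sigma> i l"
  let ?c = "(\<sigma> ^^ i) k" and ?e = "(\<sigma> ^^ i) l"
  have in_D: "?a \<in> carrier D" "?b \<in> carrier D" "?c \<in> carrier D" "?e \<in> carrier D"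
    using assms by (auto simp: cyclic_norm_closed ring_centerD)
  have comm: "?b \<otimes> ?c = ?c \<otimes> ?b"
    using ring_centerD(2)[OF cyclic_norm_center[OF assms(2)] in_D(3)] .
  have "cyclic_norm D \<sigma> (Suc i) (k \<otimes> l) = ?a \<otimes> ?b \<otimes> (?c \<otimes> ?e)"
    using Suc assms by (simp add: cyclic_norm_Suc[OF kl] ring_centerD(1))
  also have "\<dots> = ?a \<otimes> (?b \<otimes> ?c) \<otimes> ?e"
    using in_D by (simp add: m_assoc)
  also have "\<dots> = (?a \<otimes> ?c) \<otimes> (?b \<otimes> ?e)"
    using in_D by (simp add: comm m_assoc)
  finally show ?case
    using assms by (simp add: cyclic_norm_Suc)
qed simp

lemma cyclic_norm_hom:
  assumes "\<tau> \<in> ring_hom D D" "\<tau> ` carrier D = carrier D" "\<And>a. a \<in> carrier D \<Longrightarrow> \<tau> (\<sigma> a) = \<sigma> (\<tau> a)"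
    and k: "k \<in> ring_center D"
  shows "\<tau> (cyclic_norm D \<sigma> i k) = cyclic_norm D \<sigma> i (\<tau> k)"
proof (induction i)
  case 0
  then show ?case using assms(1) by (simp add: ring_hom_one)
next
  case (Suc i)
  have "\<tau> ((\<sigma> ^^ i) k) = (\<sigma> ^^ i) (\<tau> k)"
    using ring_centerD(1)[OF center_sigma_pow[OF k]] by (induction i) (simp_all add: assms(3))
  then show ?case
    using Suc k ring_hom_ring_center[OF assms(1,2) k] assms(1)
      ring_centerD(1)[OF center_sigma_pow[OF k]]
    by (simp add: cyclic_norm_Suc ring_hom_mult[OF assms(1)] cyclic_norm_closed)
qed

text \<open>Makes an \<open>m\<close>-th root of unity in S0 an element of norm one.\<close>

lemma cyclic_norm_fixed:
  assumes "k \<in> ring_center D" "\<sigma> k = k"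
  shows "cyclic_norm D \<sigma> i k = k [^] i"
proof (induction i)
  case (Suc i)
  have "(\<sigma> ^^ i) k = k" by (induction i) (simp_all add: assms)
  with Suc show ?case by (simp add: cyclic_norm_Suc assms)
qed simp

end

section \<open>Separation by the Galois condition\<close>

text \<open>Normality is automatic in an abelian group. It is what lets cosets be added through
  representatives, so that coordinates of the Galois isomorphism become additive functions of formal
  sums.\<close>

lemma tensor_relations_normal:
  assumes "\<And>x x'. \<lbrakk>x \<in> carrier A; x' \<in> carrier A\<rbrakk> \<Longrightarrow> x \<oplus>\<^bsub>A\<^esub> x' \<in> carrier A"
    and "\<And>y y'. \<lbrakk>y \<in> carrier B; y' \<in> carrier B\<rbrakk> \<Longrightarrow> y \<oplus>\<^bsub>B\<^esub> y' \<in> carrier B"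
    and "\<And>r x. \<lbrakk>r \<in> carrier R; x \<in> carrier A\<rbrakk> \<Longrightarrow> r \<odot>\<^bsub>A\<^esub> x \<in> carrier A"
    and "\<And>r y. \<lbrakk>r \<in> carrier R; y \<in> carrier B\<rbrakk> \<Longrightarrow> r \<odot>\<^bsub>B\<^esub> y \<in> carrier B"
  shows "tensor_relations R A B \<lhd> tensor_free A B"
proof -
  interpret comm_group "tensor_free A B"
    unfolding tensor_free_def by (rule abelian_free_Abelian_group)
  have diff: "p - q \<in> carrier (tensor_free A B)"
    if "p \<in> carrier (tensor_free A B)" "q \<in> carrier (tensor_free A B)" for p q
    using that keys_diff[of p q] by (auto simp: tensor_free_def)
  have frag: "frag_of (x, y) \<in> carrier (tensor_free A B)" if "x \<in> carrier A" "y \<in> carrier B" for x y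
    using that by (simp add: tensor_free_def)
  have "subgroup (tensor_relations R A B) (tensor_free A B)"
    unfolding tensor_relations_def
    by (rule generate_is_subgroup) (auto intro!: diff frag assms)
  then show ?thesis by (rule subgroup_imp_normal)
qed

text \<open>The vectors \<open>v\<close> with \<open>g v\<^sub>i = v\<^sub>1 g\<close> form an additive group containing the images
  \<open>(x \<sigma>\<^sup>j(y))\<^sub>j\<close> of the pure tensors, hence the standard basis vector at index \<open>1\<close>.\<close>

lemma (in skew_ring) galois_annihilator:
  assumes galois: "cyclic_galois_extension (base_ring D \<sigma>) (center_ring D) \<sigma> m"
    and i: "i < m" "i \<noteq> 1" "1 < m"
    and g: "g \<in> carrier D" "\<And>c. c \<in> ring_center D \<Longrightarrow> g \<otimes> (\<sigma> ^^ i) c = \<sigma> c \<otimes> g"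
  shows "g = \<zero>"
proof -
  let ?C = "self_algebra (center_ring D)"
  let ?T = "tensor_algebra (base_ring D \<sigma>) ?C ?C"
  let ?cl = "tensor_class (base_ring D \<sigma>) ?C ?C"
  note C = subcringE[OF ring_center_subcring]
  note center = ring_centerD(1)
  obtain \<phi> where iso: "\<phi> \<in> ring_iso ?T (power_ring (center_ring D) m)"
    and pure: "\<And>x y. \<lbrakk>x \<in> ring_center D; y \<in> ring_center D\<rbrakk> \<Longrightarrow>
      \<phi> (?cl (frag_of (x, y))) = (\<lambda>j\<in>{..<m}. x \<otimes> (\<sigma> ^^ j) y)"
    using galois unfolding cyclic_galois_extension_def by (auto simp: self_algebra_def)
  have normal: "tensor_relations (base_ring D \<sigma>) ?C ?C \<lhd> tensor_free ?C ?C"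
    by (rule tensor_relations_normal) (use C in \<open>auto simp: self_algebra_def\<close>)
  have carrier_free: "p \<in> carrier (tensor_free ?C ?C) \<longleftrightarrow>
      Poly_Mapping.keys p \<subseteq> ring_center D \<times> ring_center D" for p
    by (simp add: tensor_free_def self_algebra_def)
  have carrier_T: "carrier ?T = ?cl ` carrier (tensor_free ?C ?C)"
    by (auto simp: tensor_algebra_def FactGroup_def RCOSETS_def tensor_class_def)
  have closed: "\<phi> (?cl p) j \<in> ring_center D" if "p \<in> carrier (tensor_free ?C ?C)" "j < m" for p j
  proof -
    have "\<phi> (?cl p) \<in> carrier (power_ring (center_ring D) m)"
      using iso that carrier_T by (auto simp: ring_iso_def ring_hom_def)
    then show ?thesis using that(2) by (auto simp: power_ring_def)
  qed
  have add: "\<phi> (?cl (p + q)) j = \<phi> (?cl p) j \<oplus> \<phi> (?cl q) j"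
    if "p \<in> carrier (tensor_free ?C ?C)" "q \<in> carrier (tensor_free ?C ?C)" "j < m" for p q j
  proof -
    have "?cl (p + q) = ?cl p \<oplus>\<^bsub>?T\<^esub> ?cl q"
      using normal.rcos_sum[OF normal that(1,2)]
      by (simp add: tensor_class_def tensor_algebra_def FactGroup_def tensor_free_def)
    moreover have "?cl p \<in> carrier ?T" "?cl q \<in> carrier ?T"
      using that carrier_T by auto
    ultimately have "\<phi> (?cl (p + q)) = \<phi> (?cl p) \<oplus>\<^bsub>power_ring (center_ring D) m\<^esub> \<phi> (?cl q)"
      using iso by (auto simp: ring_iso_def ring_hom_def)
    then show ?thesis using that(3) by (simp add: power_ring_def)
  qed
  \<comment> \<open>Membership in the carrier is part of the induction claim: the induction on
    formal sums returns only the claim for the two parts of a difference, and \<open>add\<close>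
    needs them in the carrier.\<close>
  have balanced: "p \<in> carrier (tensor_free ?C ?C) \<and> g \<otimes> \<phi> (?cl p) i = \<phi> (?cl p) 1 \<otimes> g"
    if "Poly_Mapping.keys p \<subseteq> ring_center D \<times> ring_center D" for p
    using that
  proof (induction rule: frag_induction)
    case zero
    have "0 \<in> carrier (tensor_free ?C ?C)" by (simp add: carrier_free)
    \<comment> \<open>Additivity at \<open>0 + 0\<close> gives \<open>v = v \<oplus> v\<close> for
      this value, which forces it to be zero.\<close>
    then have "\<phi> (?cl 0) j = \<zero>" if "j < m" for j
      using add[of 0 0 j] closed[of 0 j] that center by simp
    then show ?case using i g by (simp add: carrier_free)
  next
    case (one u)
    then obtain x y where u: "u = (x, y)" "x \<in> ring_center D" "y \<in> ring_center D" by auto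
    have y: "(\<sigma> ^^ i) y \<in> carrier D" "\<sigma> y \<in> carrier D"
      using center[OF u(3)] by auto
    \<comment> \<open>The factor \<open>x\<close> is central and moves past \<open>g\<close>; the
      hypothesis on \<open>g\<close> is then applied to \<open>y\<close>.\<close>
    have "g \<otimes> (x \<otimes> (\<sigma> ^^ i) y) = x \<otimes> g \<otimes> (\<sigma> ^^ i) y"
      using g u y center ring_centerD(2)[OF u(2) g(1)] by (simp add: m_assoc[symmetric])
    also have "\<dots> = x \<otimes> \<sigma> y \<otimes> g"
      using g u y center by (simp add: m_assoc)
    finally show ?case using u i by (simp add: pure carrier_free)
  next
    case (diff p q)
    have mem: "p - q \<in> carrier (tensor_free ?C ?C)"
      using diff keys_diff[of p q] carrier_free by blast
    \<comment> \<open>\<open>add\<close> speaks of sums, so the difference is treated through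
      \<open>p = (p - q) + q\<close>, and the contribution of \<open>q\<close> is cancelled
      afterwards.\<close>
    have eq: "\<phi> (?cl p) j = \<phi> (?cl (p - q)) j \<oplus> \<phi> (?cl q) j" if "j < m" for j
      using add[OF mem _ that, of q] diff by simp
    define v where "v j = \<phi> (?cl (p - q)) j" for j
    have "(g \<otimes> v i \<oplus> g \<otimes> \<phi> (?cl q) i) = (v 1 \<otimes> g \<oplus> g \<otimes> \<phi> (?cl q) i)"
      using diff i g eq[of i] eq[of 1] center[OF closed[OF mem]] center[OF closed, of q]
      by (simp add: v_def r_distr l_distr)
    then have "g \<otimes> v i = v 1 \<otimes> g"
      using diff i g center[OF closed[OF mem]] center[OF closed, of q] by (simp add: v_def)
    then show ?case using mem by (simp add: v_def)
  qed
  \<comment> \<open>At this vector the relation \<open>g \<otimes> v i = v 1 \<otimes> g\<close>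
    becomes \<open>\<zero> = g\<close>, because \<open>i \<noteq> 1\<close>. Surjectivity of the
    Galois isomorphism puts the vector within reach of \<open>balanced\<close>.\<close>
  let ?e = "\<lambda>j\<in>{..<m}. if j = 1 then \<one> else \<zero>"
  have "?e \<in> carrier (power_ring (center_ring D) m)"
    using C(2,3) by (auto simp: power_ring_def)
  moreover have "\<phi> ` carrier ?T = carrier (power_ring (center_ring D) m)"
    using iso by (simp add: ring_iso_def bij_betw_def)
  ultimately have "?e \<in> \<phi> ` ?cl ` carrier (tensor_free ?C ?C)"
    by (simp only: carrier_T)
  then obtain p where p: "p \<in> carrier (tensor_free ?C ?C)" "\<phi> (?cl p) = ?e"
    by (elim imageE) (rule that[OF _ sym], assumption, simp only:)
  have "g \<otimes> ?e i = ?e 1 \<otimes> g"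
    using balanced[of p] p carrier_free by simp
  then show ?thesis
    using i g by simp
qed

section \<open>Automorphisms of generalized cyclic algebras\<close>

text \<open>The Galois hypothesis is recorded in the form in which it acts on coefficients: for an
  index \<open>i < m\<close> other than \<open>1\<close>, no nonzero element intertwines \<sigma>^i
  with \<sigma> on the center. The index \<open>0\<close> is included, which will exclude a constant
  term in the image of t.\<close>

locale gen_cyclic = skew_ring +
  fixes m :: nat and d :: 'a
  assumes m: "2 \<le> m"
    and d: "d \<in> Units (base_ring D \<sigma>)"
    and separates: "\<And>g i. \<lbrakk>g \<in> carrier D; i < m; i \<noteq> 1;
      \<And>c. c \<in> ring_center D \<Longrightarrow> g \<otimes> (\<sigma> ^^ i) c = \<sigma> c \<otimes> g\<rbrakk> \<Longrightarrow> g = \<zero>"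
begin

abbreviation "A \<equiv> gen_cyclic_algebra D \<sigma> m d"
abbreviation "S0 \<equiv> base_ring D \<sigma>"
abbreviation "AutD \<equiv> algebra_Aut S0 (self_algebra D)"
abbreviation "AutA \<equiv> algebra_Aut S0 A"
abbreviation "T \<equiv> {\<tau> \<in> carrier AutD. \<forall>a\<in>carrier D. \<tau> (\<sigma> a) = \<sigma> (\<tau> a)}"
abbreviation "N \<equiv> norm_one_group D \<sigma> m"
abbreviation "H \<equiv> H_map D \<sigma> m"
abbreviation "E \<equiv> extensions_of D AutA"
abbreviation "pnorm \<equiv> cyclic_norm D \<sigma>"

section \<open>Coefficient formulas for products in \<open>A\<close>\<close>

lemma d_facts: "d \<in> carrier D" "\<sigma> d = d"
proof -
  have "d \<in> carrier (base_ring D \<sigma>)"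
    using d unfolding Units_def by blast
  then show "d \<in> carrier D" "\<sigma> d = d" by simp_all
qed

lemma d_cancel:
  assumes "x \<in> carrier D" "x \<otimes> d = d"
  shows "x = \<one>"
proof -
  obtain e where e: "e \<in> carrier D" "d \<otimes> e = \<one>"
    using d unfolding Units_def by auto
  have "x = x \<otimes> d \<otimes> e" using assms(1) e d_facts by (simp add: m_assoc)
  then show ?thesis using assms(2) e by simp
qed

lemma mem_A: "g \<in> carrier A \<longleftrightarrow> (\<forall>i. g i \<in> carrier D) \<and> (\<forall>i\<ge>m. g i = \<zero>)"
  by (simp add: gen_cyclic_algebra_def skew_polys_below_iff)

lemma carrier_A: "carrier A = skew_polys_below D m"
  by (simp add: gen_cyclic_algebra_def)

lemma A_simps:
  "g \<oplus>\<^bsub>A\<^esub> h = (\<lambda>i. g i \<oplus> h i)" "\<one>\<^bsub>A\<^esub> = monomial \<one> 0" "\<zero>\<^bsub>A\<^esub> = (\<lambda>i. \<zero>)"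
  "s \<odot>\<^bsub>A\<^esub> g = (\<lambda>i. s \<otimes> g i)"
  by (simp_all add: gen_cyclic_algebra_def skew_poly_ring_def skew_monom_def)

lemma A_mult:
  assumes "g \<in> carrier A" "h \<in> carrier A"
  shows "g \<otimes>\<^bsub>A\<^esub> h = (\<lambda>n. if n < m then (g \<star> h) n \<oplus> (g \<star> h) (n + m) \<otimes> d else \<zero>)"
proof -
  have "skew_remainder D \<sigma> m d (g \<star> h) = (\<lambda>n. if n < m then (g \<star> h) n \<oplus> (g \<star> h) (n + m) \<otimes> d else \<zero>)"
    using assms m d_facts by (intro skew_remainder_eq skew_prod_closed skew_prod_degree)
      (auto simp: mem_A carrier_A[symmetric])
  then show ?thesis by (simp add: gen_cyclic_algebra_def)
qed

lemma A_mult_closed: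
  assumes "g \<in> carrier A" "h \<in> carrier A"
  shows "g \<otimes>\<^bsub>A\<^esub> h \<in> carrier A"
proof -
  have "(g \<star> h) n \<in> carrier D" for n
    using assms by (intro skew_prod_closed) (auto simp: mem_A)
  then show ?thesis using d_facts by (simp add: A_mult[OF assms]) (simp add: mem_A)
qed

lemma monomial_A: "a \<in> carrier D \<Longrightarrow> i < m \<Longrightarrow> monomial a i \<in> carrier A"
  by (simp add: mem_A skew_monom_def)

lemma group_AutA: "group AutA"
proof (rule group_algebra_Aut)
  show "\<one>\<^bsub>A\<^esub> \<in> carrier A" using m by (simp add: A_simps monomial_A)
  show "x \<otimes>\<^bsub>A\<^esub> y \<in> carrier A" if "x \<in> carrier A" "y \<in> carrier A" for x y
    using that by (rule A_mult_closed)
qed (auto simp: A_simps mem_A ring_centerD(1))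

lemma group_AutD: "group AutD"
  by (rule group_algebra_Aut) (auto simp: self_algebra_def)

lemma monomial_mult:
  assumes "a \<in> carrier D" "b \<in> carrier D" "i + j < m"
  shows "monomial a i \<otimes>\<^bsub>A\<^esub> monomial b j = monomial (a \<otimes> (\<sigma> ^^ i) b) (i + j)"
proof
  fix n
  have "monomial a i \<in> carrier A" "monomial b j \<in> carrier A"
    using assms by (auto intro: monomial_A)
  then show "(monomial a i \<otimes>\<^bsub>A\<^esub> monomial b j) n = monomial (a \<otimes> (\<sigma> ^^ i) b) (i + j) n"
    using assms d_facts
    by (auto simp: A_mult skew_prod_monomial_left monomial_closed) (auto simp: skew_monom_def)
qed

text \<open>The relation t^m = d inside \<open>A\<close>. Comparing its two sides under an
  automorphism produces the norm condition.\<close>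

lemma monomial_mult_wrap:
  assumes "a \<in> carrier D" "b \<in> carrier D" "i < m" "j < m" "i + j = m"
  shows "monomial a i \<otimes>\<^bsub>A\<^esub> monomial b j = monomial (a \<otimes> (\<sigma> ^^ i) b \<otimes> d) 0"
proof
  fix n
  have "monomial a i \<in> carrier A" "monomial b j \<in> carrier A"
    using assms(1-4) by (simp_all add: monomial_A)
  then show "(monomial a i \<otimes>\<^bsub>A\<^esub> monomial b j) n = monomial (a \<otimes> (\<sigma> ^^ i) b \<otimes> d) 0 n"
    using assms d_facts
    by (auto simp: A_mult skew_prod_monomial_left monomial_closed) (auto simp: skew_monom_def)
qed

lemma const_mult:
  assumes "a \<in> carrier D" "g \<in> carrier A"
  shows "monomial a 0 \<otimes>\<^bsub>A\<^esub> g = (\<lambda>n. a \<otimes> g n)"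
proof
  fix n
  have "monomial a 0 \<in> carrier A" using assms m by (auto intro: monomial_A)
  then show "(monomial a 0 \<otimes>\<^bsub>A\<^esub> g) n = a \<otimes> g n"
    using assms d_facts by (auto simp: A_mult skew_prod_monomial_left mem_A)
qed

lemma mult_const:
  assumes "b \<in> carrier D" "g \<in> carrier A"
  shows "g \<otimes>\<^bsub>A\<^esub> monomial b 0 = (\<lambda>n. g n \<otimes> (\<sigma> ^^ n) b)"
proof
  fix n
  have "monomial b 0 \<in> carrier A" using assms m by (auto intro: monomial_A)
  then show "(g \<otimes>\<^bsub>A\<^esub> monomial b 0) n = g n \<otimes> (\<sigma> ^^ n) b"
    using assms d_facts by (auto simp: A_mult skew_prod_monomial_right mem_A)
qed

section \<open>Automorphisms of \<open>D\<close> and those commuting with \<sigma>\<close>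

lemma AutD_iff:
  "\<tau> \<in> carrier AutD \<longleftrightarrow> \<tau> \<in> Bij (carrier D) \<and> \<tau> \<in> ring_hom D D \<and> (\<forall>s\<in>carrier S0. \<tau> s = s)"
proof
  assume \<tau>: "\<tau> \<in> carrier AutD"
  have "\<tau> s = s" if s: "s \<in> carrier S0" for s
  proof -
    have "\<forall>r\<in>carrier S0. \<forall>x\<in>carrier D. \<tau> (r \<otimes> x) = r \<otimes> \<tau> x" and one: "\<tau> \<one> = \<one>"
      using \<tau> unfolding algebra_Aut_iff self_algebra_def module.simps ring.simps monoid.simps partial_object.simps by blast+
    \<comment> \<open>Linearity evaluated at \<open>\<one>\<close> turns into pointwise fixing of
      S0; conversely, multiplicativity and fixing S0 give linearity.\<close>
    then have "\<tau> (s \<otimes> \<one>) = s \<otimes> \<tau> \<one>" using s by blast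
    then show ?thesis using s one by simp
  qed
  with \<tau> show "\<tau> \<in> Bij (carrier D) \<and> \<tau> \<in> ring_hom D D \<and> (\<forall>s\<in>carrier S0. \<tau> s = s)"
    by (auto simp: algebra_Aut_iff self_algebra_def ring_hom_def dest: Bij_imp_funcset)
next
  assume "\<tau> \<in> Bij (carrier D) \<and> \<tau> \<in> ring_hom D D \<and> (\<forall>s\<in>carrier S0. \<tau> s = s)"
  then show "\<tau> \<in> carrier AutD"
    by (auto simp: algebra_Aut_iff self_algebra_def ring_hom_def)
qed

lemma AutD_one: "\<one>\<^bsub>AutD\<^esub> = (\<lambda>a\<in>carrier D. a)"
  by (simp add: algebra_Aut_one self_algebra_def)

lemma AutD_mult:
  "\<lbrakk>\<tau> \<in> carrier AutD; \<tau>' \<in> carrier AutD\<rbrakk> \<Longrightarrow> \<tau> \<otimes>\<^bsub>AutD\<^esub> \<tau>' = compose (carrier D) \<tau> \<tau>'"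
  by (simp add: algebra_Aut_mult) (simp add: self_algebra_def)

lemma AutA_apply:
  "\<lbrakk>F \<in> carrier AutA; G \<in> carrier AutA; x \<in> carrier A\<rbrakk> \<Longrightarrow> (F \<otimes>\<^bsub>AutA\<^esub> G) x = F (G x)"
  by (simp add: algebra_Aut_mult compose_eq)

lemma AutA_closed: "\<lbrakk>F \<in> carrier AutA; x \<in> carrier A\<rbrakk> \<Longrightarrow> F x \<in> carrier A"
  unfolding algebra_Aut_iff using Bij_imp_funcset by blast

lemma AutA_eqI:
  assumes "F \<in> carrier AutA" "G \<in> carrier AutA" "\<And>x. x \<in> carrier A \<Longrightarrow> F x = G x"
  shows "F = G"
  using assms by (auto simp: algebra_Aut_iff Bij_def intro: extensionalityI)

lemma AutD_hom:
  assumes "\<tau> \<in> carrier AutD"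
  shows "ring_hom_ring D D \<tau>" "\<tau> \<in> ring_hom D D" "\<tau> ` carrier D = carrier D"
    "s \<in> carrier S0 \<Longrightarrow> \<tau> s = s" "\<tau> \<in> Bij (carrier D)" "c \<in> ring_center D \<Longrightarrow> \<tau> c \<in> ring_center D"
proof -
  show *: "\<tau> \<in> ring_hom D D" "\<tau> ` carrier D = carrier D"
    using assms by (auto simp: AutD_iff Bij_def bij_betw_def)
  show "ring_hom_ring D D \<tau>" by (rule ring_hom_ringI2[OF ring_axioms ring_axioms *(1)])
  show "c \<in> ring_center D \<Longrightarrow> \<tau> c \<in> ring_center D" by (rule ring_hom_ring_center[OF *])
qed (use assms in \<open>auto simp: AutD_iff\<close>)

lemma AutD_closed: "\<lbrakk>\<tau> \<in> carrier AutD; a \<in> carrier D\<rbrakk> \<Longrightarrow> \<tau> a \<in> carrier D"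
  by (rule ring_hom_closed[OF AutD_hom(2)])

lemma subgroup_T: "subgroup T AutD"
proof -
  interpret AutD: group AutD by (rule group_AutD)
  show ?thesis
  proof (rule AutD.subgroupI)
    have "\<one>\<^bsub>AutD\<^esub> \<in> T" using AutD.one_closed by (simp add: AutD_one)
    then show "T \<noteq> {}" by blast
  next
    fix \<tau> assume \<tau>: "\<tau> \<in> T"
    let ?\<rho> = "inv\<^bsub>AutD\<^esub> \<tau>"
    have \<rho>: "?\<rho> \<in> carrier AutD" using \<tau> by simp
    have "?\<rho> \<otimes>\<^bsub>AutD\<^esub> \<tau> = \<one>\<^bsub>AutD\<^esub>" "\<tau> \<otimes>\<^bsub>AutD\<^esub> ?\<rho> = \<one>\<^bsub>AutD\<^esub>"
      using \<tau> by simp_all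
    then have left: "?\<rho> (\<tau> a) = a" and right: "\<tau> (?\<rho> a) = a" if "a \<in> carrier D" for a
      using \<tau> \<rho> that by (auto simp: AutD_mult AutD_one compose_def fun_eq_iff split: if_splits)
    have "?\<rho> (\<sigma> a) = \<sigma> (?\<rho> a)" if a: "a \<in> carrier D" for a
    proof -
      have "?\<rho> (\<sigma> a) = ?\<rho> (\<sigma> (\<tau> (?\<rho> a)))" using right[OF a] by simp
      also have "\<dots> = ?\<rho> (\<tau> (\<sigma> (?\<rho> a)))" using \<tau> AutD_closed[OF \<rho> a] by simp
      also have "\<dots> = \<sigma> (?\<rho> a)" using AutD_closed[OF \<rho> a] by (intro left) simp
      finally show ?thesis .
    qed
    then show "?\<rho> \<in> T" using \<rho> by simp
  next
    fix \<tau> \<tau>' assume "\<tau> \<in> T" "\<tau>' \<in> T"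
    then show "\<tau> \<otimes>\<^bsub>AutD\<^esub> \<tau>' \<in> T"
      using AutD.m_closed[of \<tau> \<tau>'] by (simp add: AutD_mult compose_eq AutD_closed)
  qed blast
qed

lemma T_subset: "\<tau> \<in> T \<Longrightarrow> \<tau> \<in> carrier AutD"
  by simp

lemma T_norm:
  assumes "\<tau> \<in> T" "k \<in> ring_center D"
  shows "\<tau> (pnorm i k) = pnorm i (\<tau> k)"
  by (rule cyclic_norm_hom[OF AutD_hom(2,3)]) (use assms in auto)

section \<open>Central elements of norm one\<close>

lemma pnorm_one: "pnorm i \<one> = \<one>"
proof (induction i)
  case (Suc i)
  then show ?case using subcringE(3)[OF ring_center_subcring] by (simp add: cyclic_norm_Suc)
qed simp

lemma pnorm_1: "k \<in> ring_center D \<Longrightarrow> pnorm (Suc 0) k = k"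
  by (simp add: cyclic_norm_Suc ring_centerD(1))

lemma N_inverse:
  assumes k: "k \<in> ring_center D" and norm: "pnorm m k = \<one>"
  obtains l where "l \<in> ring_center D" "k \<otimes> l = \<one>" "l \<otimes> k = \<one>" "pnorm m l = \<one>"
proof -
  \<comment> \<open>The norm of \<open>k\<close> is \<open>k\<close> times this product of its other
    conjugates \<sigma>(k), ..., \<sigma>^{m-1}(k), so norm one makes the product an inverse of
    \<open>k\<close>.\<close>
  define l where "l = \<sigma> (pnorm (m - 1) k)"
  have l: "l \<in> ring_center D"
    unfolding l_def using center_sigma_pow[OF cyclic_norm_center[OF k], of 1] by simp
  have kl: "k \<otimes> l = \<one>"
    using cyclic_norm_add[OF k, of 1 "m - 1"] norm m k by (simp add: l_def pnorm_1)
  have "pnorm m (k \<otimes> l) = pnorm m l"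
    using k l norm by (simp add: cyclic_norm_mult cyclic_norm_closed)
  then have "pnorm m l = \<one>" using kl by (simp add: pnorm_one)
  then show ?thesis
    using that l kl ring_centerD(2)[OF k ring_centerD(1)[OF l]] by simp
qed

lemma mem_N: "k \<in> carrier N \<longleftrightarrow> k \<in> ring_center D \<and> pnorm m k = \<one>"
proof
  assume "k \<in> ring_center D \<and> pnorm m k = \<one>"
  moreover from this obtain l where "l \<in> ring_center D" "k \<otimes> l = \<one>" "l \<otimes> k = \<one>"
    using N_inverse by metis
  ultimately show "k \<in> carrier N" by (auto simp: norm_one_group_def Units_def)
qed (auto simp: norm_one_group_def Units_def)

lemma N_mult: "k \<otimes>\<^bsub>N\<^esub> l = k \<otimes> l"
  by (simp add: norm_one_group_def units_of_def)

lemma N_one: "\<one> \<in> carrier N"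
  using subcringE(3)[OF ring_center_subcring] by (simp add: mem_N pnorm_one)

lemma N_mult_closed: "\<lbrakk>k \<in> carrier N; l \<in> carrier N\<rbrakk> \<Longrightarrow> k \<otimes> l \<in> carrier N"
  using subcringE(6)[OF ring_center_subcring] by (simp add: mem_N cyclic_norm_mult)

lemma N_T_closed: "\<lbrakk>\<tau> \<in> T; k \<in> carrier N\<rbrakk> \<Longrightarrow> \<tau> k \<in> carrier N"
  using T_norm[of \<tau> k m] ring_hom_one[OF AutD_hom(2)[of \<tau>]] by (simp add: mem_N AutD_hom(6))

section \<open>The maps \<open>H\<close> as automorphisms of \<open>A\<close>\<close>

lemma H_coeff: "g \<in> carrier A \<Longrightarrow> H \<tau> k g = (\<lambda>i. \<tau> (g i) \<otimes> pnorm i k)"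
  by (simp add: H_map_def carrier_A)

lemma H_closed:
  assumes "\<tau> \<in> carrier AutD" "k \<in> ring_center D" "g \<in> carrier A"
  shows "H \<tau> k g \<in> carrier A"
proof -
  interpret \<tau>: ring_hom_ring D D \<tau> by (rule AutD_hom(1)[OF assms(1)])
  show ?thesis using assms(2,3) by (simp add: H_coeff mem_A cyclic_norm_closed)
qed

text \<open>Stated pointwise and for arbitrary central elements, because it serves to exhibit the
  inverse of \<open>H \<tau> k\<close> before that map is known to be an automorphism. Commuting
  with \<sigma> lets \<tau> pass inside the partial norm of \<open>k'\<close>, and partial norms are
  multiplicative.\<close>

lemma H_compose:
  assumes T: "\<tau> \<in> T" "\<tau>' \<in> T" and k: "k \<in> ring_center D" "k' \<in> ring_center D" and g: "g \<in> carrier A"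
  shows "H \<tau> k (H \<tau>' k' g) = H (\<tau> \<otimes>\<^bsub>AutD\<^esub> \<tau>') (\<tau> k' \<otimes> k) g"
proof -
  note Aut = T_subset[OF T(1)] T_subset[OF T(2)]
  interpret \<tau>: ring_hom_ring D D \<tau> by (rule AutD_hom(1)[OF Aut(1)])
  interpret \<tau>': ring_hom_ring D D \<tau>' by (rule AutD_hom(1)[OF Aut(2)])
  have "\<tau> (\<tau>' (g i) \<otimes> pnorm i k') \<otimes> pnorm i k
      = compose (carrier D) \<tau> \<tau>' (g i) \<otimes> pnorm i (\<tau> k' \<otimes> k)" for i
    using g k AutD_hom(6)[OF Aut(1) k(2)] T_norm[OF T(1) k(2)]
    by (simp add: mem_A compose_eq cyclic_norm_closed cyclic_norm_mult m_assoc)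
  then show ?thesis
    using H_closed[OF Aut(2) k(2) g] g by (simp add: H_coeff AutD_mult[OF Aut])
qed

text \<open>\<open>prod\<close> is the statement for skew polynomials before reduction: centrality
  of \<open>pnorm i k\<close> and the cocycle identity collect both norm factors into
  \<open>pnorm n k\<close>. In the reduction, \<open>norm_wrap\<close> gives the carried coefficient
  the same factor, and \<open>\<tau> d = d\<close> with centrality of that factor lets it pass
  \<open>d\<close>.\<close>

lemma H_mult:
  assumes T: "\<tau> \<in> T" and k: "k \<in> carrier N" and g: "g \<in> carrier A" "h \<in> carrier A"
  shows "H \<tau> k (g \<otimes>\<^bsub>A\<^esub> h) = H \<tau> k g \<otimes>\<^bsub>A\<^esub> H \<tau> k h"
proof
  fix n
  note Aut = T_subset[OF T]
  interpret \<tau>: ring_hom_ring D D \<tau> by (rule AutD_hom(1)[OF Aut])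
  have kc: "k \<in> ring_center D" and norm: "pnorm m k = \<one>" using k by (auto simp: mem_N)
  have gh: "g i \<in> carrier D" "h i \<in> carrier D" for i using g by (auto simp: mem_A)
  have \<tau>_pow: "\<tau> ((\<sigma> ^^ i) a) = (\<sigma> ^^ i) (\<tau> a)" if "a \<in> carrier D" for a i
    using that T by (induction i) auto
  have prod: "(H \<tau> k g \<star> H \<tau> k h) n = \<tau> ((g \<star> h) n) \<otimes> pnorm n k" for n
  proof -
    have "\<tau> (g i) \<otimes> pnorm i k \<otimes> (\<sigma> ^^ i) (\<tau> (h j) \<otimes> pnorm j k)
        = \<tau> (g i \<otimes> (\<sigma> ^^ i) (h j)) \<otimes> pnorm (i + j) k" for i j
    proof -
      let ?x = "\<tau> (g i)" and ?y = "(\<sigma> ^^ i) (\<tau> (h j))"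
        and ?p = "pnorm i k" and ?q = "(\<sigma> ^^ i) (pnorm j k)"
      have in_D: "?x \<in> carrier D" "?y \<in> carrier D" "?p \<in> carrier D" "?q \<in> carrier D"
        using gh kc by (auto simp: cyclic_norm_closed)
      have "?x \<otimes> ?p \<otimes> (?y \<otimes> ?q) = ?x \<otimes> (?p \<otimes> ?y) \<otimes> ?q"
        using in_D by (simp add: m_assoc)
      also have "\<dots> = ?x \<otimes> ?y \<otimes> (?p \<otimes> ?q)"
        using in_D ring_centerD(2)[OF cyclic_norm_center[OF kc] in_D(2)] by (simp add: m_assoc)
      finally show ?thesis
        using gh kc by (simp add: cyclic_norm_add cyclic_norm_closed \<tau>_pow)
    qed
    then have "(H \<tau> k g \<star> H \<tau> k h) n
        = (\<Oplus>i\<in>{..n}. \<tau> (g i \<otimes> (\<sigma> ^^ i) (h (n - i))) \<otimes> pnorm n k)"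
      unfolding skew_prod_coeff using g gh kc
      by (intro finsum_cong') (auto simp: H_coeff cyclic_norm_closed)
    also have "\<dots> = (\<Oplus>i\<in>{..n}. \<tau> (g i \<otimes> (\<sigma> ^^ i) (h (n - i)))) \<otimes> pnorm n k"
      using gh kc by (intro finsum_ldistr[symmetric]) (auto simp: cyclic_norm_closed)
    also have "\<dots> = \<tau> ((g \<star> h) n) \<otimes> pnorm n k"
      unfolding skew_prod_coeff using gh by (subst \<tau>.hom_finsum) (auto simp: comp_def)
    finally show ?thesis .
  qed
  have norm_wrap: "pnorm (n + m) k = pnorm n k"
    using cyclic_norm_add[OF kc, of n m] kc by (simp add: norm cyclic_norm_closed)
  have in_D: "(g \<star> h) i \<in> carrier D" for i
    by (rule skew_prod_closed) (auto simp: gh)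
  have "\<tau> d = d"
    using AutD_hom(4)[OF Aut] d by (simp add: Units_def)
  moreover have "pnorm n k \<otimes> d = d \<otimes> pnorm n k"
    using ring_centerD(2)[OF cyclic_norm_center[OF kc] d_facts(1)] .
  ultimately have "\<tau> (if n < m then (g \<star> h) n \<oplus> (g \<star> h) (n + m) \<otimes> d else \<zero>) \<otimes> pnorm n k
      = (if n < m then \<tau> ((g \<star> h) n) \<otimes> pnorm n k \<oplus> \<tau> ((g \<star> h) (n + m)) \<otimes> pnorm n k \<otimes> d else \<zero>)"
    using in_D d_facts kc by (simp add: cyclic_norm_closed l_distr m_assoc)
  moreover have "H \<tau> k (g \<otimes>\<^bsub>A\<^esub> h) n = \<tau> ((g \<otimes>\<^bsub>A\<^esub> h) n) \<otimes> pnorm n k"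
    by (simp only: H_coeff[OF A_mult_closed[OF g]])
  ultimately show "H \<tau> k (g \<otimes>\<^bsub>A\<^esub> h) n = (H \<tau> k g \<otimes>\<^bsub>A\<^esub> H \<tau> k h) n"
    unfolding A_mult[OF g]
      A_mult[OF H_closed[OF Aut kc g(1)] H_closed[OF Aut kc g(2)]] prod norm_wrap by simp
qed

lemma monomial_inject: "monomial a i = monomial b i \<longleftrightarrow> a = b"
  by (auto simp: skew_monom_def fun_eq_iff)

lemma H_one: "g \<in> carrier A \<Longrightarrow> H \<one>\<^bsub>AutD\<^esub> \<one> g = g"
  by (simp add: H_coeff AutD_one mem_A pnorm_one)

lemma H_extensional: "H \<tau> k \<in> extensional (carrier A)"
  by (simp add: H_map_def carrier_A)

lemma H_closed_Aut:
  assumes \<tau>: "\<tau> \<in> T" and k: "k \<in> carrier N"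
  shows "H \<tau> k \<in> carrier AutA"
proof -
  interpret AutD: group AutD by (rule group_AutD)
  note Aut = T_subset[OF \<tau>]
  interpret \<tau>: ring_hom_ring D D \<tau> by (rule AutD_hom(1)[OF Aut])
  have kc: "k \<in> ring_center D" using k by (simp add: mem_N)
  define \<rho> where "\<rho> = inv\<^bsub>AutD\<^esub> \<tau>"
  have \<rho>: "\<rho> \<in> T"
    unfolding \<rho>_def by (rule subgroup.m_inv_closed[OF subgroup_T \<tau>])
  note Aut\<rho> = T_subset[OF \<rho>]
  interpret \<rho>: ring_hom_ring D D \<rho> by (rule AutD_hom(1)[OF Aut\<rho>])
  have \<rho>\<tau>: "\<rho> \<otimes>\<^bsub>AutD\<^esub> \<tau> = \<one>\<^bsub>AutD\<^esub>" "\<tau> \<otimes>\<^bsub>AutD\<^esub> \<rho> = \<one>\<^bsub>AutD\<^esub>"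
    unfolding \<rho>_def using Aut by (rule AutD.l_inv, rule AutD.r_inv)
  then have \<tau>\<rho>: "\<tau> (\<rho> a) = a" if "a \<in> carrier D" for a
    using AutD_mult[OF Aut Aut\<rho>] that by (metis AutD_one compose_eq restrict_apply')
  obtain l where l: "l \<in> ring_center D" "k \<otimes> l = \<one>" "l \<otimes> k = \<one>"
    using N_inverse[OF kc] k by (auto simp: mem_N)
  have \<rho>l: "\<rho> l \<in> ring_center D" by (rule AutD_hom(6)[OF Aut\<rho> l(1)])
  have "\<rho> k \<otimes> \<rho> l = \<rho> (k \<otimes> l)"
    using ring_centerD(1)[OF kc] ring_centerD(1)[OF l(1)] by simp
  then have inv1: "\<rho> k \<otimes> \<rho> l = \<one>" using l by simp
  have inv2: "\<tau> (\<rho> l) \<otimes> k = \<one>" using \<tau>\<rho>[OF ring_centerD(1)[OF l(1)]] l by simp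
  \<comment> \<open>The composition law determines the inverse: its automorphism must be the inverse
    \<rho> of \<tau>, and its parameter must be \<rho> applied to the inverse \<open>l\<close> of
    \<open>k\<close>.\<close>
  have "bij_betw (H \<tau> k) (carrier A) (carrier A)"
  proof (rule bij_betw_byWitness[where f' = "H \<rho> (\<rho> l)"])
    show "\<forall>g\<in>carrier A. H \<rho> (\<rho> l) (H \<tau> k g) = g"
      using H_compose[OF \<rho> \<tau> \<rho>l kc] by (simp add: \<rho>\<tau> inv1 H_one)
    show "\<forall>g\<in>carrier A. H \<tau> k (H \<rho> (\<rho> l) g) = g"
      using H_compose[OF \<tau> \<rho> kc \<rho>l] by (simp add: \<rho>\<tau> inv2 H_one)
  qed (use H_closed Aut Aut\<rho> kc \<rho>l in blast)+
  then have Bij: "H \<tau> k \<in> Bij (carrier A)"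
    using H_extensional by (simp add: Bij_def)
  show ?thesis
    unfolding algebra_Aut_iff
  proof (intro conjI ballI)
    show "H \<tau> k \<in> Bij (carrier A)" by (rule Bij)
    show "H \<tau> k (g \<otimes>\<^bsub>A\<^esub> h) = H \<tau> k g \<otimes>\<^bsub>A\<^esub> H \<tau> k h" if "g \<in> carrier A" "h \<in> carrier A" for g h
      using H_mult[OF \<tau> k that] .
    show "H \<tau> k (g \<oplus>\<^bsub>A\<^esub> h) = H \<tau> k g \<oplus>\<^bsub>A\<^esub> H \<tau> k h" if "g \<in> carrier A" "h \<in> carrier A" for g h
    proof -
      have "g \<oplus>\<^bsub>A\<^esub> h \<in> carrier A" using that by (simp add: A_simps mem_A)
      then show ?thesis
        using that kc by (simp add: H_coeff A_simps) (simp add: mem_A l_distr cyclic_norm_closed)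
    qed
    show "H \<tau> k \<one>\<^bsub>A\<^esub> = \<one>\<^bsub>A\<^esub>"
    proof -
      have "monomial \<one> 0 \<in> carrier A" using m by (intro monomial_A) auto
      then show ?thesis
        using kc by (auto simp: H_coeff A_simps skew_monom_def cyclic_norm_closed)
    qed
    show "H \<tau> k (s \<odot>\<^bsub>A\<^esub> g) = s \<odot>\<^bsub>A\<^esub> H \<tau> k g" if "s \<in> carrier S0" "g \<in> carrier A" for s g
    proof -
      have "(\<lambda>i. s \<otimes> g i) \<in> carrier A" using that by (simp add: mem_A)
      then show ?thesis
        using that kc AutD_hom(4)[OF Aut that(1)]
        by (simp add: H_coeff A_simps) (simp add: mem_A m_assoc cyclic_norm_closed)
    qed
  qed
qed

lemma H_monomial:
  assumes "\<tau> \<in> carrier AutD" "k \<in> ring_center D" "a \<in> carrier D" "i < m"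
  shows "H \<tau> k (monomial a i) = monomial (\<tau> a \<otimes> pnorm i k) i"
proof -
  interpret \<tau>: ring_hom_ring D D \<tau> by (rule AutD_hom(1)[OF assms(1)])
  show ?thesis
    using monomial_A[OF assms(3,4)] assms by (auto simp: H_coeff skew_monom_def cyclic_norm_closed)
qed

text \<open>The images of the constants recover \<tau>, since \<open>pnorm 0 k\<close> is
  \<open>\<one>\<close>; the image of t, which lies in \<open>A\<close> because
  \<open>m \<ge> 2\<close>, recovers \<open>k\<close>.\<close>

lemma H_inject:
  assumes \<tau>: "\<tau> \<in> T" "\<tau>' \<in> T" and k: "k \<in> carrier N" "k' \<in> carrier N"
    and eq: "H \<tau> k = H \<tau>' k'"
  shows "\<tau> = \<tau>'" "k = k'"
proof -
  note Aut = T_subset[OF \<tau>(1)] T_subset[OF \<tau>(2)]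
  have kc: "k \<in> ring_center D" "k' \<in> ring_center D" using k by (auto simp: mem_N)
  have m': "0 < m" "1 < m" using m by auto
  have eq_const: "monomial (\<tau> a \<otimes> pnorm 0 k) 0 = monomial (\<tau>' a \<otimes> pnorm 0 k') 0" if "a \<in> carrier D" for a
    using eq H_monomial[OF Aut(1) kc(1) that m'(1)] H_monomial[OF Aut(2) kc(2) that m'(1)] by simp
  have "\<tau> a = \<tau>' a" if "a \<in> carrier D" for a
    using eq_const[OF that] AutD_closed[OF Aut(1) that] AutD_closed[OF Aut(2) that] by (simp add: monomial_inject)
  then show "\<tau> = \<tau>'"
    using AutD_hom(5)[OF Aut(1)] AutD_hom(5)[OF Aut(2)] by (intro extensionalityI) (auto simp: Bij_def)
  have "monomial (\<tau> \<one> \<otimes> pnorm 1 k) 1 = monomial (\<tau>' \<one> \<otimes> pnorm 1 k') 1"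
    using eq H_monomial[OF Aut(1) kc(1) one_closed m'(2)] H_monomial[OF Aut(2) kc(2) one_closed m'(2)] by simp
  then show "k = k'"
    using kc ring_hom_one[OF AutD_hom(2)[OF Aut(1)]] ring_hom_one[OF AutD_hom(2)[OF Aut(2)]]
    by (simp add: monomial_inject pnorm_1 ring_centerD(1))
qed

lemma H_compose_Aut:
  assumes \<tau>: "\<tau> \<in> T" "\<tau>' \<in> T" and k: "k \<in> carrier N" "k' \<in> carrier N"
  shows "H \<tau> k \<otimes>\<^bsub>AutA\<^esub> H \<tau>' k' = H (\<tau> \<otimes>\<^bsub>AutD\<^esub> \<tau>') (\<tau> k' \<otimes> k)"
proof (rule AutA_eqI)
  interpret AutA: group AutA by (rule group_AutA)
  note T_mult = subgroup.m_closed[OF subgroup_T \<tau>]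
  show "H \<tau> k \<otimes>\<^bsub>AutA\<^esub> H \<tau>' k' \<in> carrier AutA"
    using H_closed_Aut \<tau> k by blast
  show "H (\<tau> \<otimes>\<^bsub>AutD\<^esub> \<tau>') (\<tau> k' \<otimes> k) \<in> carrier AutA"
    using H_closed_Aut[OF T_mult] N_mult_closed[OF N_T_closed[OF \<tau>(1) k(2)] k(1)] by blast
  show "(H \<tau> k \<otimes>\<^bsub>AutA\<^esub> H \<tau>' k') g = H (\<tau> \<otimes>\<^bsub>AutD\<^esub> \<tau>') (\<tau> k' \<otimes> k) g" if "g \<in> carrier A" for g
    using AutA_apply[OF H_closed_Aut[OF \<tau>(1) k(1)] H_closed_Aut[OF \<tau>(2) k(2)] that]
      H_compose[OF \<tau> _ _ that, of k k'] k by (simp add: mem_N)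
qed

section \<open>Classification of the extensions of a fixed \<tau>\<close>

lemma H_in_extensions:
  assumes "\<tau> \<in> T" "k \<in> carrier N"
  shows "H \<tau> k \<in> E \<tau>"
  using H_closed_Aut[OF assms] H_monomial[OF T_subset[OF assms(1)], of k _ 0] assms(2) m
    AutD_closed[OF T_subset[OF assms(1)]]
  by (auto simp: extensions_of_def mem_N)

lemma extension_eq_H:
  assumes \<tau>: "\<tau> \<in> T" and F: "F \<in> E \<tau>"
  obtains k where "k \<in> carrier N" "F = H \<tau> k"
proof -
  note Aut = T_subset[OF \<tau>]
  interpret \<tau>: ring_hom_ring D D \<tau> by (rule AutD_hom(1)[OF Aut])
  have FA: "F \<in> carrier AutA" and F_const: "\<And>a. a \<in> carrier D \<Longrightarrow> F (monomial a 0) = monomial (\<tau> a) 0"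
    using F by (auto simp: extensions_of_def)
  have F_mult: "F (g \<otimes>\<^bsub>A\<^esub> h) = F g \<otimes>\<^bsub>A\<^esub> F h" if "g \<in> carrier A" "h \<in> carrier A" for g h
    using FA that by (simp add: algebra_Aut_iff)
  have F_add: "F (g \<oplus>\<^bsub>A\<^esub> h) = F g \<oplus>\<^bsub>A\<^esub> F h" if "g \<in> carrier A" "h \<in> carrier A" for g h
    using FA that by (simp add: algebra_Aut_iff)
  have m': "0 < m" "1 < m" using m by auto
  define u where "u = F (monomial \<one> 1)"
  have u: "u \<in> carrier A"
    unfolding u_def by (rule AutA_closed[OF FA monomial_A[OF one_closed m'(2)]])
  then have u_D: "u i \<in> carrier D" for i by (simp add: mem_A)
  have twist: "u i \<otimes> (\<sigma> ^^ i) b = \<sigma> b \<otimes> u i" if b: "b \<in> carrier D" for i b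
  proof -
    \<comment> \<open>Surjectivity of \<tau>: the relation obtained for the values
      \<open>\<tau> a\<close> then holds for every \<open>b\<close>.\<close>
    obtain a where a: "a \<in> carrier D" "b = \<tau> a"
      using b AutD_hom(3)[OF Aut] by blast
    have "monomial \<one> 1 \<otimes>\<^bsub>A\<^esub> monomial a 0 = monomial (\<sigma> a) 0 \<otimes>\<^bsub>A\<^esub> monomial \<one> 1"
      using a m' by (simp add: monomial_mult)
    then have "F (monomial \<one> 1 \<otimes>\<^bsub>A\<^esub> monomial a 0) = F (monomial (\<sigma> a) 0 \<otimes>\<^bsub>A\<^esub> monomial \<one> 1)"
      by simp
    then have "u \<otimes>\<^bsub>A\<^esub> monomial b 0 = monomial (\<tau> (\<sigma> a)) 0 \<otimes>\<^bsub>A\<^esub> u"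
      using a m' by (simp add: F_mult monomial_A F_const u_def)
    moreover have "\<tau> (\<sigma> a) = \<sigma> b" using \<tau> a by simp
    ultimately have "u \<otimes>\<^bsub>A\<^esub> monomial b 0 = monomial (\<sigma> b) 0 \<otimes>\<^bsub>A\<^esub> u"
      by simp
    then show ?thesis
      using b u by (simp add: mult_const const_mult fun_eq_iff)
  qed
  define k where "k = u 1"
  have u_eq: "u = monomial k 1"
  proof
    fix i
    show "u i = monomial k 1 i"
    proof (cases "i < m \<and> i \<noteq> 1")
      case True
      \<comment> \<open>The twist relation, restricted to central \<open>b\<close>, is the
        hypothesis of \<open>separates\<close>.\<close>
      then have "u i = \<zero>"
        using twist ring_centerD(1) u_D by (intro separates) auto
      then show ?thesis using True by (simp add: skew_monom_def)
    next
      case False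
      then show ?thesis using u by (auto simp: skew_monom_def k_def mem_A)
    qed
  qed
  have kc: "k \<in> ring_center D"
  proof (rule ring_centerI)
    show "k \<in> carrier D" by (simp add: k_def u_D)
    fix a assume "a \<in> carrier D"
    \<comment> \<open>At index \<open>1\<close> the twist relation says that \<open>k\<close>
      commutes with \<open>\<sigma> b\<close>, and \<sigma> is onto.\<close>
    then obtain b where "b \<in> carrier D" "a = \<sigma> b"
      using sigma_bij by (auto simp: bij_betw_def)
    then show "k \<otimes> a = a \<otimes> k" using twist[of b 1] by (simp add: k_def)
  qed
  note kD = ring_centerD(1)[OF kc]
  have t_pow: "F (monomial \<one> i) = monomial (pnorm i k) i" if "i < m" for i
    using that
  proof (induction i)
    case 0
    then show ?case by (simp add: F_const)
  next
    case (Suc i)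
    have "monomial \<one> (Suc i) = monomial \<one> i \<otimes>\<^bsub>A\<^esub> monomial \<one> 1"
      using Suc by (simp add: monomial_mult)
    then have "F (monomial \<one> (Suc i)) = monomial (pnorm i k) i \<otimes>\<^bsub>A\<^esub> u"
      using Suc m' by (simp add: F_mult monomial_A u_def)
    then show ?case
      using Suc kc kD by (simp add: u_eq monomial_mult cyclic_norm_closed cyclic_norm_Suc)
  qed
  have F_monomial: "F (monomial a i) = monomial (\<tau> a \<otimes> pnorm i k) i" if "a \<in> carrier D" "i < m" for a i
  proof -
    have "monomial a i = monomial a 0 \<otimes>\<^bsub>A\<^esub> monomial \<one> i"
      using that by (simp add: monomial_mult)
    then have "F (monomial a i) = monomial (\<tau> a) 0 \<otimes>\<^bsub>A\<^esub> monomial (pnorm i k) i"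
      using that m' by (simp add: F_mult monomial_A F_const t_pow)
    then show ?thesis using that kc by (simp add: monomial_mult cyclic_norm_closed)
  qed
  have norm: "pnorm m k = \<one>"
  proof -
    \<comment> \<open>The image of \<open>d\<close> is computed twice: as a constant it is
      \<open>\<tau> d = d\<close>, and through t^{m-1} t it is \<open>pnorm m k \<otimes> d\<close>.
      Cancelling the unit \<open>d\<close> leaves norm one.\<close>
    have d_mult: "monomial d 0 = monomial \<one> (m - 1) \<otimes>\<^bsub>A\<^esub> monomial \<one> 1"
      using m m' d_facts by (subst monomial_mult_wrap) auto
    have "monomial (\<tau> d) 0 = F (monomial \<one> (m - 1) \<otimes>\<^bsub>A\<^esub> monomial \<one> 1)"
      by (simp only: F_const[OF d_facts(1), symmetric] d_mult)
    also have "\<dots> = monomial (pnorm (m - 1) k) (m - 1) \<otimes>\<^bsub>A\<^esub> monomial k 1"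
      using m' t_pow[of "m - 1"] u_eq by (simp add: F_mult monomial_A u_def)
    also have "\<dots> = monomial (pnorm (m - 1) k \<otimes> (\<sigma> ^^ (m - 1)) k \<otimes> d) 0"
      using m m' kc kD by (subst monomial_mult_wrap) (auto simp: cyclic_norm_closed)
    also have "pnorm (m - 1) k \<otimes> (\<sigma> ^^ (m - 1)) k = pnorm m k"
      using cyclic_norm_Suc[OF kc, of "m - 1"] m' by simp
    finally have "\<tau> d = pnorm m k \<otimes> d"
      by (simp only: monomial_inject)
    moreover have "\<tau> d = d"
      using AutD_hom(4)[OF Aut] d by (simp add: Units_def)
    ultimately show ?thesis using d_cancel cyclic_norm_closed[OF kc] by simp
  qed
  then have k: "k \<in> carrier N" using kc by (simp add: mem_N)
  have "F g = H \<tau> k g" if g: "g \<in> carrier A" for g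
  proof -
    \<comment> \<open>Truncations of \<open>g\<close> replace its expansion as a sum of monomials,
      so that additivity of \<open>F\<close> for two summands is enough for the induction.\<close>
    define g' where "g' n = (\<lambda>i. if i < n then g i else \<zero>)" for n :: nat
    have g': "g' n \<in> carrier A" for n using g by (simp add: g'_def mem_A)
    have gD: "g i \<in> carrier D" for i using g by (simp add: mem_A)
    have zero: "g' 0 = monomial \<zero> 0" by (simp add: g'_def skew_monom_def)
    have "F (g' n) = H \<tau> k (g' n)" if "n \<le> m" for n
      using that
    proof (induction n)
      case 0
      then show ?case
        using m' F_monomial[of \<zero> 0] H_monomial[OF Aut kc, of \<zero> 0] by (simp add: zero)
    next
      case (Suc n)
      have n: "monomial (g n) n \<in> carrier A" using Suc gD by (intro monomial_A) auto
      have split: "g' (Suc n) = g' n \<oplus>\<^bsub>A\<^esub> monomial (g n) n"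
        using gD by (auto simp: A_simps g'_def skew_monom_def fun_eq_iff)
      have "F (g' (Suc n)) = H \<tau> k (g' n) \<oplus>\<^bsub>A\<^esub> H \<tau> k (monomial (g n) n)"
        using Suc n g' gD F_monomial[of "g n" n] H_monomial[OF Aut kc, of "g n" n]
        by (simp add: split F_add)
      also have "\<dots> = H \<tau> k (g' (Suc n))"
        using H_closed_Aut[OF \<tau> k] n g' by (simp add: split algebra_Aut_iff)
      finally show ?case .
    qed
    moreover have "g' m = g" using g by (auto simp: g'_def mem_A)
    ultimately show ?thesis by (metis order_refl)
  qed
  then have "F = H \<tau> k" by (intro AutA_eqI FA H_closed_Aut \<tau> k)
  then show ?thesis using that k by blast
qed

text \<open>Reconciles the coefficientwise definition of \<open>H\<close> with the formula in powers
  of kt taken in \<open>A\<close>. Such a power is bracketed to the left, so the recursion of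
  \<open>pnorm\<close> evaluates it directly, and below degree \<open>m\<close> no carry
  occurs.\<close>

lemma H_sum:
  assumes \<tau>: "\<tau> \<in> T" and k: "k \<in> carrier N" and g: "g \<in> carrier A"
  shows "H \<tau> k g = (\<Oplus>\<^bsub>A\<^esub>i\<in>{..<m}. monomial (\<tau> (g i)) 0 \<otimes>\<^bsub>A\<^esub> (monomial k 1 [^]\<^bsub>A\<^esub> i))"
proof -
  interpret A: abelian_monoid A
    by (rule abelian_monoidI) (simp_all add: A_simps mem_A a_assoc, simp add: a_comm)
  have kc: "k \<in> ring_center D" using k by (simp add: mem_N)
  note kD = ring_centerD(1)[OF kc]
  have m': "0 < m" "1 < m" using m by auto
  define b where "b i = \<tau> (g i) \<otimes> pnorm i k" for i
  have g_D: "\<tau> (g i) \<in> carrier D" for i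
    using AutD_closed[OF T_subset[OF \<tau>]] g by (simp add: mem_A)
  then have b_D: "b i \<in> carrier D" for i
    using kc by (simp add: b_def cyclic_norm_closed)
  have pow: "monomial k 1 [^]\<^bsub>A\<^esub> i = monomial (pnorm i k) i" if "i < m" for i
    using that
  proof (induction i)
    case 0
    then show ?case by (simp add: nat_pow_def A_simps)
  next
    case (Suc i)
    then have "monomial k 1 [^]\<^bsub>A\<^esub> Suc i = monomial (pnorm i k) i \<otimes>\<^bsub>A\<^esub> monomial k 1"
      by (simp add: nat_pow_def)
    then show ?case
      using Suc kc kD by (simp add: monomial_mult cyclic_norm_closed cyclic_norm_Suc)
  qed
  have "(\<Oplus>\<^bsub>A\<^esub>i\<in>{..<m}. monomial (\<tau> (g i)) 0 \<otimes>\<^bsub>A\<^esub> (monomial k 1 [^]\<^bsub>A\<^esub> i))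
      = (\<Oplus>\<^bsub>A\<^esub>i\<in>{..<m}. monomial (b i) i)"
  proof (rule A.finsum_cong')
    fix i assume "i \<in> {..<m}"
    then show "monomial (\<tau> (g i)) 0 \<otimes>\<^bsub>A\<^esub> (monomial k 1 [^]\<^bsub>A\<^esub> i) = monomial (b i) i"
      using pow[of i] g_D kc by (simp add: monomial_mult cyclic_norm_closed b_def)
  qed (use b_D in \<open>auto intro: monomial_A\<close>)
  moreover have "(\<Oplus>\<^bsub>A\<^esub>i\<in>{..<n}. monomial (b i) i) = (\<lambda>i. if i < n then b i else \<zero>)" if "n \<le> m" for n
    using that
  proof (induction n)
    case 0
    then show ?case by (simp add: A_simps)
  next
    case (Suc n)
    have "(\<Oplus>\<^bsub>A\<^esub>i\<in>{..<Suc n}. monomial (b i) i)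
        = monomial (b n) n \<oplus>\<^bsub>A\<^esub> (\<Oplus>\<^bsub>A\<^esub>i\<in>{..<n}. monomial (b i) i)"
      unfolding lessThan_Suc using Suc.prems b_D
      by (intro A.finsum_insert) (auto intro: monomial_A)
    also have "(\<Oplus>\<^bsub>A\<^esub>i\<in>{..<n}. monomial (b i) i) = (\<lambda>i. if i < n then b i else \<zero>)"
      using Suc by simp
    also have "monomial (b n) n \<oplus>\<^bsub>A\<^esub> \<dots> = (\<lambda>i. if i < Suc n then b i else \<zero>)"
      using b_D by (auto simp: A_simps skew_monom_def fun_eq_iff less_Suc_eq)
    finally show ?case .
  qed
  moreover have "H \<tau> k g = (\<lambda>i. if i < m then b i else \<zero>)"
    using H_closed[OF T_subset[OF \<tau>] kc g] g by (auto simp: H_coeff b_def mem_A fun_eq_iff)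
  ultimately show ?thesis by simp
qed

section \<open>Group structure of the extensions\<close>

lemma AutD_one_T: "\<one>\<^bsub>AutD\<^esub> \<in> T"
  by (rule subgroup.one_closed[OF subgroup_T])

text \<open>Elements of \<open>AutD\<close> are extensional, so the unit of \<open>AutD\<close> is
  the identity restricted to the carrier and not \<open>id\<close> itself. Only values on
  coefficients matter for \<open>H\<close>.\<close>

lemma H_id: "H id k = H \<one>\<^bsub>AutD\<^esub> k"
  unfolding H_map_def by (rule restrict_ext) (auto simp: AutD_one skew_polys_below_iff)

lemma extensions_cong: "(\<And>a. a \<in> carrier D \<Longrightarrow> \<tau> a = \<tau>' a) \<Longrightarrow> E \<tau> = E \<tau>'"
  by (simp add: extensions_of_def)

lemma extensions_id: "E id = E \<one>\<^bsub>AutD\<^esub>"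
  by (rule extensions_cong) (simp add: AutD_one)

lemma AutA_one_eq_H: "\<one>\<^bsub>AutA\<^esub> = H \<one>\<^bsub>AutD\<^esub> \<one>"
proof (rule AutA_eqI)
  interpret AutA: group AutA by (rule group_AutA)
  show "\<one>\<^bsub>AutA\<^esub> \<in> carrier AutA" by simp
  show "H \<one>\<^bsub>AutD\<^esub> \<one> \<in> carrier AutA" by (rule H_closed_Aut[OF AutD_one_T N_one])
qed (simp add: algebra_Aut_one[of S0 A] H_one)

lemma H_bij:
  assumes "\<tau> \<in> T"
  shows "bij_betw (H \<tau>) (carrier N) (E \<tau>)"
  unfolding bij_betw_def
proof
  show "inj_on (H \<tau>) (carrier N)"
    using H_inject(2)[OF assms assms] by (rule inj_onI)
  show "H \<tau> ` carrier N = E \<tau>"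
  proof
    show "E \<tau> \<subseteq> H \<tau> ` carrier N"
    proof
      fix F assume "F \<in> E \<tau>"
      then show "F \<in> H \<tau> ` carrier N"
        by (rule extension_eq_H[OF assms]) (erule (1) rev_image_eqI)
    qed
  qed (use H_in_extensions[OF assms] in blast)
qed

lemma extensions_id_subgroup: "subgroup (E id) AutA"
proof -
  interpret AutA: group AutA by (rule group_AutA)
  show ?thesis
  proof (rule AutA.subgroupI)
    show "E id \<noteq> {}" using H_in_extensions[OF AutD_one_T N_one] extensions_id by auto
  next
    fix F assume F: "F \<in> E id"
    then have FA: "F \<in> carrier AutA" by (simp add: extensions_of_def)
    have "(inv\<^bsub>AutA\<^esub> F) (monomial a 0) = monomial a 0" if a: "a \<in> carrier D" for a
    proof -
      have mono: "monomial a 0 \<in> carrier A" using a m by (intro monomial_A) auto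
      have "(inv\<^bsub>AutA\<^esub> F) (F (monomial a 0)) = (inv\<^bsub>AutA\<^esub> F \<otimes>\<^bsub>AutA\<^esub> F) (monomial a 0)"
        by (rule AutA_apply[OF AutA.inv_closed[OF FA] FA mono, symmetric])
      also have "\<dots> = monomial a 0"
        using FA mono by (simp add: algebra_Aut_one)
      finally show ?thesis using F a by (simp add: extensions_of_def)
    qed
    then show "inv\<^bsub>AutA\<^esub> F \<in> E id" using FA by (simp add: extensions_of_def)
  next
    fix F G assume "F \<in> E id" "G \<in> E id"
    moreover from this have "(F \<otimes>\<^bsub>AutA\<^esub> G) (monomial a 0) = monomial a 0" if "a \<in> carrier D" for a
      using that m AutA_apply[of F G "monomial a 0"] monomial_A[of a 0]
      by (simp add: extensions_of_def)
    ultimately show "F \<otimes>\<^bsub>AutA\<^esub> G \<in> E id" by (simp add: extensions_of_def)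
  qed (auto simp: extensions_of_def)
qed

text \<open>For the identity the factor \<open>\<tau> k'\<close> of the composition law is
  \<open>k'\<close> itself, and the reversed order of the two parameters is harmless because they
  are central. The isomorphism is the inverse of the parametrization of \<open>E id\<close> by
  \<open>N\<close>.\<close>

lemma extensions_id_iso: "AutA\<lparr>carrier := E id\<rparr> \<cong> N"
proof -
  let ?h = "inv_into (carrier N) (H \<one>\<^bsub>AutD\<^esub>)"
  have bij: "bij_betw (H \<one>\<^bsub>AutD\<^esub>) (carrier N) (E id)"
    using H_bij[OF AutD_one_T] by (simp add: extensions_id)
  have h: "?h (H \<one>\<^bsub>AutD\<^esub> k) = k" if "k \<in> carrier N" for k
    using bij_betw_inv_into_left[OF bij that] .
  have mult: "?h (F \<otimes>\<^bsub>AutA\<^esub> G) = ?h F \<otimes> ?h G" if F: "F \<in> E id" and G: "G \<in> E id" for F G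
  proof -
    obtain k where k: "k \<in> carrier N" "F = H \<one>\<^bsub>AutD\<^esub> k"
      by (rule extension_eq_H[OF AutD_one_T F[unfolded extensions_id]])
    obtain l where l: "l \<in> carrier N" "G = H \<one>\<^bsub>AutD\<^esub> l"
      by (rule extension_eq_H[OF AutD_one_T G[unfolded extensions_id]])
    have in_D: "k \<in> ring_center D" "l \<in> carrier D" using k l ring_centerD(1) by (auto simp: mem_N)
    have "\<one>\<^bsub>AutD\<^esub> l = l" using in_D by (simp add: AutD_one)
    moreover have "\<one>\<^bsub>AutD\<^esub> \<otimes>\<^bsub>AutD\<^esub> \<one>\<^bsub>AutD\<^esub> = \<one>\<^bsub>AutD\<^esub>"
      by (rule monoid.l_one[OF group.is_monoid[OF group_AutD] T_subset[OF AutD_one_T]])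
    ultimately have "F \<otimes>\<^bsub>AutA\<^esub> G = H \<one>\<^bsub>AutD\<^esub> (l \<otimes> k)"
      using H_compose_Aut[OF AutD_one_T AutD_one_T k(1) l(1)] by (simp only: k(2) l(2))
    also have "l \<otimes> k = k \<otimes> l" using ring_centerD(2)[OF in_D] by simp
    finally have "?h (F \<otimes>\<^bsub>AutA\<^esub> G) = k \<otimes> l"
      by (simp only: h[OF N_mult_closed[OF k(1) l(1)]])
    then show ?thesis by (simp only: k(2) l(2) h[OF k(1)] h[OF l(1)])
  qed
  have bij': "bij_betw ?h (E id) (carrier N)" by (rule bij_betw_inv_into[OF bij])
  have "?h \<in> hom (AutA\<lparr>carrier := E id\<rparr>) N"
    by (rule homI) (simp_all add: N_mult mult bij_betwE[OF bij', rule_format])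
  with bij' have "?h \<in> iso (AutA\<lparr>carrier := E id\<rparr>) N"
    by (simp add: iso_def)
  then show ?thesis by (auto simp: is_iso_def)
qed

text \<open>A subgroup contains the identity of \<open>A\<close>, which extends \<tau> only if
  \<tau> fixes \<open>D\<close> pointwise. The claim thus reduces to the extensions of the
  identity.\<close>

lemma extensions_subgroup_iso:
  assumes "subgroup (E \<tau>) AutA" "\<tau> \<in> carrier AutD"
  shows "AutA\<lparr>carrier := E \<tau>\<rparr> \<cong> N"
proof -
  have one: "\<one>\<^bsub>AutA\<^esub> \<in> E \<tau>" by (rule subgroup.one_closed[OF assms(1)])
  have "\<tau> a = a" if a: "a \<in> carrier D" for a
  proof -
    have "monomial a 0 \<in> carrier A" using a m by (intro monomial_A) auto
    moreover have "\<one>\<^bsub>AutA\<^esub> (monomial a 0) = monomial (\<tau> a) 0"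
      using one a unfolding extensions_of_def by blast
    ultimately have "monomial a 0 = monomial (\<tau> a) 0"
      by (simp add: algebra_Aut_one)
    then show ?thesis by (simp add: monomial_inject)
  qed
  then have "E \<tau> = E id" by (intro extensions_cong) simp
  then show ?thesis using extensions_id_iso by simp
qed

text \<open>If F and G extend the same \<tau>, then F^{-1} G fixes the constants. The argument uses
  the values on constants alone and asks nothing of \<tau> with respect to \<sigma>.\<close>

lemma extensions_coset:
  assumes \<tau>: "\<tau> \<in> carrier AutD" and F: "F \<in> E \<tau>"
  shows "E \<tau> = F <#\<^bsub>AutA\<^esub> E id"
proof -
  interpret AutA: group AutA by (rule group_AutA)
  have FA: "F \<in> carrier AutA" using F by (simp add: extensions_of_def)
  have mono: "monomial a 0 \<in> carrier A" if "a \<in> carrier D" for a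
    using that m by (intro monomial_A) auto
  have "F \<otimes>\<^bsub>AutA\<^esub> G \<in> E \<tau>" if "G \<in> E id" for G
    using that F FA by (simp add: extensions_of_def AutA_apply mono)
  moreover have "\<exists>G'\<in>E id. G = F \<otimes>\<^bsub>AutA\<^esub> G'" if G: "G \<in> E \<tau>" for G
  proof
    have GA: "G \<in> carrier AutA" using G by (simp add: extensions_of_def)
    show "G = F \<otimes>\<^bsub>AutA\<^esub> (inv\<^bsub>AutA\<^esub> F \<otimes>\<^bsub>AutA\<^esub> G)"
      using FA GA by (simp add: AutA.m_assoc[symmetric])
    have "(inv\<^bsub>AutA\<^esub> F \<otimes>\<^bsub>AutA\<^esub> G) (monomial a 0) = monomial a 0" if a: "a \<in> carrier D" for a
    proof -
      have "(inv\<^bsub>AutA\<^esub> F \<otimes>\<^bsub>AutA\<^esub> G) (monomial a 0) = (inv\<^bsub>AutA\<^esub> F) (F (monomial a 0))"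
        using AutA_apply[OF AutA.inv_closed[OF FA] GA mono[OF a]] F G a
        by (simp add: extensions_of_def)
      also have "\<dots> = (inv\<^bsub>AutA\<^esub> F \<otimes>\<^bsub>AutA\<^esub> F) (monomial a 0)"
        by (rule AutA_apply[OF AutA.inv_closed[OF FA] FA mono[OF a], symmetric])
      also have "\<dots> = monomial a 0"
        using FA mono[OF a] by (simp add: algebra_Aut_one)
      finally show ?thesis .
    qed
    then show "inv\<^bsub>AutA\<^esub> F \<otimes>\<^bsub>AutA\<^esub> G \<in> E id" using FA GA by (simp add: extensions_of_def)
  qed
  ultimately show ?thesis by (auto simp: l_coset_def)
qed

lemma H_pow:
  assumes \<tau>: "\<tau> \<in> T" and w: "w \<in> carrier N" "w \<in> carrier S0"
  shows "H \<tau> w [^]\<^bsub>AutA\<^esub> (n::nat) = H (\<tau> [^]\<^bsub>AutD\<^esub> n) (w [^] n)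
    \<and> \<tau> [^]\<^bsub>AutD\<^esub> n \<in> T \<and> w [^] n \<in> carrier N"
proof (induction n)
  case 0
  show ?case using AutD_one_T N_one by (simp add: AutA_one_eq_H)
next
  case (Suc n)
  have \<tau>n: "\<tau> [^]\<^bsub>AutD\<^esub> n \<in> T" and wn: "w [^] n \<in> carrier N" using Suc by auto
  \<comment> \<open>As \<open>w\<close> lies in S0, every power of \<tau> fixes it, so the twist in
    the composition law disappears and both arguments are raised to powers separately.\<close>
  have "(\<tau> [^]\<^bsub>AutD\<^esub> n) w = w" using AutD_hom(4)[OF T_subset[OF \<tau>n] w(2)] .
  moreover have "w \<otimes> w [^] n = w [^] n \<otimes> w"
    using w by (intro ring_centerD(2)) auto
  ultimately have "H \<tau> w [^]\<^bsub>AutA\<^esub> Suc n = H (\<tau> [^]\<^bsub>AutD\<^esub> n \<otimes>\<^bsub>AutD\<^esub> \<tau>) (w [^] n \<otimes> w)"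
    using Suc H_compose_Aut[OF \<tau>n \<tau> wn w(1)] by simp
  then show ?case
    using subgroup.m_closed[OF subgroup_T \<tau>n \<tau>] N_mult_closed[OF wn w(1)]
    unfolding nat_pow_Suc monoid.nat_pow_Suc[OF group.is_monoid[OF group_AutD]] by blast
qed

text \<open>By \<open>H_pow\<close> and injectivity, the n-th power is trivial exactly when the n-th
  powers of \<tau> and \<open>w\<close> both are. Infinite order is included: there
  \<open>ord\<close> is 0, the \<open>lcm\<close> is 0, and so is the cardinality of an infinite
  set.\<close>

lemma card_generate_H:
  assumes \<tau>: "\<tau> \<in> T" and w: "w \<in> carrier S0" "w [^] m = \<one>"
    and prim: "\<And>j. 0 < j \<Longrightarrow> j < m \<Longrightarrow> w [^] j \<noteq> \<one>"
  shows "H \<tau> w \<in> carrier AutA"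
    and "card (generate AutA {H \<tau> w}) = lcm m (group.ord AutD \<tau>)"
proof -
  interpret AutD: group AutD by (rule group_AutD)
  interpret AutA: group AutA by (rule group_AutA)
  have wN: "w \<in> carrier N" using w by (simp add: mem_N cyclic_norm_fixed)
  show HA: "H \<tau> w \<in> carrier AutA" by (rule H_closed_Aut[OF \<tau> wN])
  \<comment> \<open>Primitivity in the form that the multiplicative order of \<open>w\<close> is
    exactly \<open>m\<close>; the exponent is reduced modulo \<open>m\<close>.\<close>
  have w_pow: "w [^] n = \<one> \<longleftrightarrow> m dvd n" for n :: nat
  proof -
    have wD: "w \<in> carrier D" using w by simp
    have "w [^] n = w [^] (m * (n div m) + n mod m)" by simp
    also have "\<dots> = (w [^] m) [^] (n div m) \<otimes> w [^] (n mod m)"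
      using wD by (simp only: nat_pow_mult nat_pow_pow)
    also have "\<dots> = w [^] (n mod m)"
      using w wD by simp
    finally have "w [^] n = w [^] (n mod m)" .
    moreover have "w [^] (n mod m) = \<one> \<longleftrightarrow> n mod m = 0"
      using prim[of "n mod m"] m by (cases "n mod m = 0") auto
    ultimately show ?thesis by (simp add: dvd_eq_mod_eq_0)
  qed
  \<comment> \<open>Comparing multiples determines the order by antisymmetry of divisibility, with
    no case distinction for infinite order, since 0 divides only 0.\<close>
  have dvd_iff: "AutA.ord (H \<tau> w) dvd n \<longleftrightarrow> lcm m (AutD.ord \<tau>) dvd n" for n
  proof -
    note pow = H_pow[OF \<tau> wN w(1), of n]
    have "AutA.ord (H \<tau> w) dvd n \<longleftrightarrow> H (\<tau> [^]\<^bsub>AutD\<^esub> n) (w [^] n) = H \<one>\<^bsub>AutD\<^esub> \<one>"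
      using AutA.pow_eq_id[OF HA, of n] pow unfolding AutA_one_eq_H by simp
    also have "\<dots> \<longleftrightarrow> \<tau> [^]\<^bsub>AutD\<^esub> n = \<one>\<^bsub>AutD\<^esub> \<and> w [^] n = \<one>"
    proof -
      have T: "\<tau> [^]\<^bsub>AutD\<^esub> n \<in> T" and N: "w [^] n \<in> carrier N" using pow by blast+
      show ?thesis
      proof
        assume "H (\<tau> [^]\<^bsub>AutD\<^esub> n) (w [^] n) = H \<one>\<^bsub>AutD\<^esub> \<one>"
        from H_inject[OF T AutD_one_T N N_one this]
        show "\<tau> [^]\<^bsub>AutD\<^esub> n = \<one>\<^bsub>AutD\<^esub> \<and> w [^] n = \<one>" ..
      qed simp
    qed
    also have "\<dots> \<longleftrightarrow> lcm m (AutD.ord \<tau>) dvd n"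
      using AutD.pow_eq_id[OF T_subset[OF \<tau>], of n] w_pow[of n] by auto
    finally show ?thesis .
  qed
  have "AutA.ord (H \<tau> w) = lcm m (AutD.ord \<tau>)"
    using dvd_iff[of "AutA.ord (H \<tau> w)"] dvd_iff[of "lcm m (AutD.ord \<tau>)"]
    by (intro dvd_antisym) simp_all
  then show "card (generate AutA {H \<tau> w}) = lcm m (AutD.ord \<tau>)"
    using AutA.generate_pow_card[OF HA] by simp
qed

text \<open>The embedding sends \<tau> to \<open>H \<tau> \<one>\<close>. With the parameter
  \<open>\<one>\<close>, which every \<tau> fixes, the composition law is plain
  multiplicativity.\<close>

lemma commuting_automorphisms_embed:
  "\<exists>G. subgroup G AutA \<and> AutD\<lparr>carrier := T\<rparr> \<cong> AutA\<lparr>carrier := G\<rparr>"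
proof -
  interpret AutD: group AutD by (rule group_AutD)
  interpret AutA: group AutA by (rule group_AutA)
  let ?h = "\<lambda>\<tau>. H \<tau> \<one>"
  interpret T: group "AutD\<lparr>carrier := T\<rparr>"
    by (rule subgroup.subgroup_is_group[OF subgroup_T group_AutD])
  have mult: "?h (\<tau> \<otimes>\<^bsub>AutD\<^esub> \<tau>') = ?h \<tau> \<otimes>\<^bsub>AutA\<^esub> ?h \<tau>'" if "\<tau> \<in> T" "\<tau>' \<in> T" for \<tau> \<tau>'
    using H_compose_Aut[OF that N_one N_one] ring_hom_one[OF AutD_hom(2)[OF T_subset[OF that(1)]]] by simp
  have closed: "?h \<tau> \<in> carrier AutA" if "\<tau> \<in> T" for \<tau>
    by (rule H_closed_Aut[OF that N_one])
  have hom: "?h \<in> hom (AutD\<lparr>carrier := T\<rparr>) AutA"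
  proof (rule homI)
    fix \<tau> assume "\<tau> \<in> carrier (AutD\<lparr>carrier := T\<rparr>)"
    then have \<tau>: "\<tau> \<in> T" by simp
    show "?h \<tau> \<in> carrier AutA" by (rule closed[OF \<tau>])
    fix \<tau>' assume "\<tau>' \<in> carrier (AutD\<lparr>carrier := T\<rparr>)"
    then have \<tau>': "\<tau>' \<in> T" by simp
    show "?h (\<tau> \<otimes>\<^bsub>AutD\<lparr>carrier := T\<rparr>\<^esub> \<tau>') = ?h \<tau> \<otimes>\<^bsub>AutA\<^esub> ?h \<tau>'"
      using mult[OF \<tau> \<tau>'] by simp
  qed
  then interpret h: group_hom "AutD\<lparr>carrier := T\<rparr>" AutA ?h
    by (intro group_hom.intro group_hom_axioms.intro T.is_group group_AutA)
  have image: "subgroup (?h ` T) AutA"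
    using h.img_is_subgroup by simp
  have bij: "bij_betw ?h T (?h ` T)"
    by (rule inj_on_imp_bij_betw, rule inj_onI, rule H_inject(1)[OF _ _ N_one N_one])
  have "?h \<in> iso (AutD\<lparr>carrier := T\<rparr>) (AutA\<lparr>carrier := ?h ` T\<rparr>)"
    using hom bij by (simp add: iso_def hom_def)
  then have "AutD\<lparr>carrier := T\<rparr> \<cong> AutA\<lparr>carrier := ?h ` T\<rparr>"
    unfolding is_iso_def by blast
  with image show ?thesis by blast
qed

end

theorem corollary14:
  fixes D :: "('a, 'x) ring_scheme" and \<sigma> :: "'a \<Rightarrow> 'a" and m :: nat and d :: 'a
    and C S\<^sub>0 :: "('a, 'x) ring_scheme" and A :: "('a, nat \<Rightarrow> 'a) module" and N :: "'a monoid"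
    and H :: "('a \<Rightarrow> 'a) \<Rightarrow> 'a \<Rightarrow> (nat \<Rightarrow> 'a) \<Rightarrow> nat \<Rightarrow> 'a"
    and AutD :: "('a \<Rightarrow> 'a) monoid" and AutA :: "((nat \<Rightarrow> 'a) \<Rightarrow> nat \<Rightarrow> 'a) monoid"
    and T :: "('a \<Rightarrow> 'a) set" and E :: "('a \<Rightarrow> 'a) \<Rightarrow> ((nat \<Rightarrow> 'a) \<Rightarrow> nat \<Rightarrow> 'a) set"
  defines "C \<equiv> center_ring D"
    and "S\<^sub>0 \<equiv> base_ring D \<sigma>"
    and "A \<equiv> gen_cyclic_algebra D \<sigma> m d"
    and "N \<equiv> norm_one_group D \<sigma> m"
    and "H \<equiv> H_map D \<sigma> m"
    and "AutD \<equiv> algebra_Aut S\<^sub>0 (self_algebra D)"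
    and "AutA \<equiv> algebra_Aut S\<^sub>0 A"
    and "T \<equiv> {\<tau> \<in> carrier AutD. \<forall>a\<in>carrier D. \<tau> (\<sigma> a) = \<sigma> (\<tau> a)}"
    and "E \<equiv> extensions_of D AutA"
  assumes "azumaya D"
    and "\<exists>n. has_constant_rank C (self_algebra D) n"
    and "\<sigma> \<in> ring_iso D D"
    and "m \<ge> 2"
    and "group.ord (BijGroup (carrier C)) (restrict \<sigma> (carrier C)) = m"
    and "cyclic_galois_extension S\<^sub>0 C \<sigma> m"
    and "d \<in> Units S\<^sub>0"
    and "associative_algebra A"
  shows "(\<forall>\<tau>\<in>T. \<exists>k\<in>carrier N. H \<tau> k \<in> E \<tau>) \<and>
    (\<forall>\<tau>\<in>T. \<forall>k\<in>carrier N.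
        H \<tau> k \<in> carrier AutA \<and>
        (\<forall>g\<in>carrier A. H \<tau> k g =
           (\<Oplus>\<^bsub>A\<^esub>i\<in>{..<m}. skew_monom D (\<tau> (g i)) 0 \<otimes>\<^bsub>A\<^esub> (skew_monom D k 1 [^]\<^bsub>A\<^esub> i)))) \<and>
    (\<forall>\<tau>\<in>carrier AutD. subgroup (E \<tau>) AutA \<longrightarrow> AutA\<lparr>carrier := E \<tau>\<rparr> \<cong> N) \<and>
    (subgroup (E id) AutA \<and> AutA\<lparr>carrier := E id\<rparr> \<cong> N) \<and>
    (\<forall>\<tau>\<in>carrier AutD. \<forall>F\<in>E \<tau>. E \<tau> = F <#\<^bsub>AutA\<^esub> E id) \<and>
    (\<forall>\<tau>\<in>T. bij_betw (H \<tau>) (carrier N) (E \<tau>)) \<and>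
    (\<forall>\<omega>\<in>carrier S\<^sub>0. \<omega> [^]\<^bsub>D\<^esub> m = \<one>\<^bsub>D\<^esub> \<and> (\<forall>j. 0 < j \<and> j < m \<longrightarrow> \<omega> [^]\<^bsub>D\<^esub> j \<noteq> \<one>\<^bsub>D\<^esub>) \<longrightarrow>
        (\<forall>\<tau>\<in>T.
           subgroup (generate AutA {H \<tau> \<omega>}) AutA \<and>
           (\<forall>s>0. group.ord AutD \<tau> = s \<longrightarrow>
              card (generate AutA {H \<tau> \<omega>}) = lcm m s \<and>
              (coprime m s \<longrightarrow> card (generate AutA {H \<tau> \<omega>}) = m * s)) \<and>
           (group.ord AutD \<tau> = 0 \<longrightarrow> infinite (generate AutA {H \<tau> \<omega>}))) \<and>
        subgroup (generate AutA {H id \<omega>}) AutA \<and>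
        card (generate AutA {H id \<omega>}) = m) \<and>
    (\<exists>G. subgroup G AutA \<and> AutD\<lparr>carrier := T\<rparr> \<cong> AutA\<lparr>carrier := G\<rparr>)"
proof -
  note defs = C_def S\<^sub>0_def A_def N_def H_def AutD_def AutA_def T_def E_def
  have "ring D" using \<open>azumaya D\<close> by (simp add: azumaya_def)
  then interpret skew: skew_ring D \<sigma>
    using \<open>\<sigma> \<in> ring_iso D D\<close> by (intro skew_ring.intro skew_ring_axioms.intro)
  interpret g: gen_cyclic D \<sigma> m d
  proof unfold_locales
    show "2 \<le> m" by fact
    show "d \<in> Units (base_ring D \<sigma>)"
      using \<open>d \<in> Units S\<^sub>0\<close> by (simp only: S\<^sub>0_def)
    \<comment> \<open>Here the Galois hypothesis becomes the separation property;
      \<open>2 \<le> m\<close> provides the index \<open>1\<close> of the basis vector used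
      there.\<close>
    show "g = \<zero>\<^bsub>D\<^esub>" if "g \<in> carrier D" "i < m" "i \<noteq> 1"
      "\<And>c. c \<in> ring_center D \<Longrightarrow> g \<otimes>\<^bsub>D\<^esub> (\<sigma> ^^ i) c = \<sigma> c \<otimes>\<^bsub>D\<^esub> g" for g i
      using \<open>cyclic_galois_extension S\<^sub>0 C \<sigma> m\<close> that \<open>2 \<le> m\<close>
      by (intro skew.galois_annihilator[of m i g]) (auto simp: C_def S\<^sub>0_def)
  qed
  interpret AutA: group AutA unfolding defs by (rule g.group_AutA)
  \<comment> \<open>Any element of norm one gives an extension; the witness taken is
    \<open>\<one>\<close>.\<close>
  have T_ext: "\<exists>k\<in>carrier N. H \<tau> k \<in> E \<tau>" if "\<tau> \<in> T" for \<tau>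
    using g.H_in_extensions[OF _ g.N_one] g.N_one that unfolding defs by blast
  have H_Aut: "H \<tau> k \<in> carrier AutA" if "\<tau> \<in> T" "k \<in> carrier N" for \<tau> k
    using that unfolding defs by (rule g.H_closed_Aut)
  have H_sum: "H \<tau> k h =
      (\<Oplus>\<^bsub>A\<^esub>i\<in>{..<m}. skew_monom D (\<tau> (h i)) 0 \<otimes>\<^bsub>A\<^esub> (skew_monom D k 1 [^]\<^bsub>A\<^esub> i))"
    if "\<tau> \<in> T" "k \<in> carrier N" "h \<in> carrier A" for \<tau> k h
    using that unfolding defs by (rule g.H_sum)
  have sub_iso: "AutA\<lparr>carrier := E \<tau>\<rparr> \<cong> N" if "\<tau> \<in> carrier AutD" "subgroup (E \<tau>) AutA" for \<tau>
    using that(2,1) unfolding defs by (rule g.extensions_subgroup_iso)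
  have id: "subgroup (E id) AutA" "AutA\<lparr>carrier := E id\<rparr> \<cong> N"
    unfolding defs by (rule g.extensions_id_subgroup, rule g.extensions_id_iso)
  have coset: "E \<tau> = F <#\<^bsub>AutA\<^esub> E id" if "\<tau> \<in> carrier AutD" "F \<in> E \<tau>" for \<tau> F
    using that unfolding defs by (rule g.extensions_coset)
  have bij: "bij_betw (H \<tau>) (carrier N) (E \<tau>)" if "\<tau> \<in> T" for \<tau>
    using that unfolding defs by (rule g.H_bij)
  have cyclic: "subgroup (generate AutA {H \<tau> \<omega>}) AutA \<and>
      card (generate AutA {H \<tau> \<omega>}) = lcm m (group.ord AutD \<tau>)"
    if "\<tau> \<in> T" "\<omega> \<in> carrier S\<^sub>0" "\<omega> [^]\<^bsub>D\<^esub> m = \<one>\<^bsub>D\<^esub>"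
      "\<And>j. 0 < j \<Longrightarrow> j < m \<Longrightarrow> \<omega> [^]\<^bsub>D\<^esub> j \<noteq> \<one>\<^bsub>D\<^esub>" for \<tau> \<omega>
  proof
    have "H \<tau> \<omega> \<in> carrier AutA"
      using that unfolding defs by (rule g.card_generate_H)
    then show "subgroup (generate AutA {H \<tau> \<omega>}) AutA"
      by (intro AutA.generate_is_subgroup) simp
    show "card (generate AutA {H \<tau> \<omega>}) = lcm m (group.ord AutD \<tau>)"
      using that unfolding defs by (rule g.card_generate_H)
  qed
  have roots: "(\<forall>\<tau>\<in>T.
           subgroup (generate AutA {H \<tau> \<omega>}) AutA \<and>
           (\<forall>s>0. group.ord AutD \<tau> = s \<longrightarrow>
              card (generate AutA {H \<tau> \<omega>}) = lcm m s \<and>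
              (coprime m s \<longrightarrow> card (generate AutA {H \<tau> \<omega>}) = m * s)) \<and>
           (group.ord AutD \<tau> = 0 \<longrightarrow> infinite (generate AutA {H \<tau> \<omega>}))) \<and>
        subgroup (generate AutA {H id \<omega>}) AutA \<and>
        card (generate AutA {H id \<omega>}) = m"
    if "\<omega> \<in> carrier S\<^sub>0" "\<omega> [^]\<^bsub>D\<^esub> m = \<one>\<^bsub>D\<^esub>"
      "\<And>j. 0 < j \<Longrightarrow> j < m \<Longrightarrow> \<omega> [^]\<^bsub>D\<^esub> j \<noteq> \<one>\<^bsub>D\<^esub>" for \<omega>
  proof (intro conjI ballI allI impI)
    fix \<tau> assume \<tau>: "\<tau> \<in> T"
    note cyc = cyclic[OF \<tau> that]
    show "subgroup (generate AutA {H \<tau> \<omega>}) AutA" using cyc by simp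
    show "card (generate AutA {H \<tau> \<omega>}) = lcm m s" if "group.ord AutD \<tau> = s" for s
      using cyc that by simp
    show "card (generate AutA {H \<tau> \<omega>}) = m * s" if "group.ord AutD \<tau> = s" "coprime m s" for s
      using cyc that by (simp add: lcm_coprime)
    \<comment> \<open>The cardinality is \<open>lcm m 0 = 0\<close>; the generated set contains the
      identity, so it is not empty and must be infinite.\<close>
    show "infinite (generate AutA {H \<tau> \<omega>})" if "group.ord AutD \<tau> = 0"
      using cyc that generate.one[of AutA "{H \<tau> \<omega>}"] by (auto simp: card_eq_0_iff)
  next
    \<comment> \<open>The unit of \<open>AutD\<close> stands in for \<open>id\<close>. It has order
      1, and \<open>lcm m 1 = m\<close>.\<close>
    have one: "\<one>\<^bsub>AutD\<^esub> \<in> T" "H id \<omega> = H \<one>\<^bsub>AutD\<^esub> \<omega>" "group.ord AutD \<one>\<^bsub>AutD\<^esub> = 1"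
      unfolding defs by (rule g.AutD_one_T, rule g.H_id, rule group.ord_id[OF g.group_AutD])
    show "subgroup (generate AutA {H id \<omega>}) AutA" "card (generate AutA {H id \<omega>}) = m"
      using cyclic[OF one(1) that] by (simp_all add: one)
  qed
  have embed: "\<exists>G. subgroup G AutA \<and> AutD\<lparr>carrier := T\<rparr> \<cong> AutA\<lparr>carrier := G\<rparr>"
    unfolding defs by (rule g.commuting_automorphisms_embed)
  show ?thesis
    by (intro conjI ballI impI T_ext H_Aut H_sum sub_iso id coset bij embed roots) auto
qed

end
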